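(* Fix $n\geq 2$, an inner radius $r>0$, and a number $\alpha>0$. Let $p$ be the solution of $$p'=-(1+p^2)\left(1+\frac{n-1}{\rho}\,p\right),\qquad p(r)=\alpha .$$ Then there exist a unique radius $R>r$, a smooth radial function $u(x)=U(|x|)$ on $A_{r,R}=B_R\setminus\overline{B_r}$, and constants $a,C\in\mathbb{R}$ and $\Gamma<0$ such that $$ \begin{cases} -\operatorname{div}\left(\dfrac{Du}{\sqrt{1+|Du|^2}}\right)=\dfrac{1}{\sqrt{1+|Du|^2}} & \text{in }A_{r,R},\\ u=a & \text{on }\partial A_{r,R},\\ \partial_\nu u=\Gamma H+C & \text{on }\partial A_{r,R}. \end{cases} $$ Consequently, the conclusion that the domain is a ball in the following theorem is false if the assumption $\Gamma\geq 0$ is removed: "Let $n\geq 2$ and $\gamma\in(0,1)$. Let $\Omega\subset\mathbb{R}^n$ be a bounded connected domain with $\partial\Omega$ of class $C^{4,\gamma}$ (the boundary is not assumed to be connected), and suppose that $u\in C^{4,\gamma}(\overline\Omega)$ solves $-\operatorname{div}(Du/\sqrt{1+|Du|^2})=1/\sqrt{1+|Du|^2}$ in $\Omega$, with $u=a$ and $\partial_\nu u=\Gamma H+C$ on $\partial\Omega$, where $a,C\in\mathbb{R}$ and $\Gamma\geq 0$ are constants. Then there exist $x_0\in\mathbb{R}^n$ and $R>0$ such that $\Omega=B_R(x_0)$; moreover, $u$ is radial about $x_0$."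
   Context: The function $p=p(\rho)$ depends on the radial variable $\rho\geq r$, and the prime denotes $d/d\rho$. $B_\rho(x_0)$ is the open ball in $\mathbb{R}^n$ of radius $\rho$ centered at $x_0$, and $B_\rho=B_\rho(0)$. $\nu$ is the outer unit normal of the domain under consideration, and $H$ is the normalized mean curvature of its boundary, $H=-\frac{1}{n-1}\operatorname{div}_{\partial\Omega}\nu$, so that $H_{\partial B_R}=-1/R$ for the ball $B_R$; for the annulus $A_{r,R}$ this gives $H=1/r$ on $\partial B_r$ and $H=-1/R$ on $\partial B_R$. *)

theory Defs
  imports "HOL-Analysis.Analysis"
begin

definition partial_deriv :: "'a::euclidean_space \<Rightarrow> ('a \<Rightarrow> real) \<Rightarrow> 'a \<Rightarrow> real" where
  "partial_deriv b f x = frechet_derivative f (at x) b"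

definition iter_partial :: "'a::euclidean_space list \<Rightarrow> ('a \<Rightarrow> real) \<Rightarrow> 'a \<Rightarrow> real" where
  "iter_partial bs f = foldr partial_deriv bs f"

definition grad :: "('a::euclidean_space \<Rightarrow> real) \<Rightarrow> 'a \<Rightarrow> 'a" where
  "grad f x = (\<Sum>b\<in>Basis. partial_deriv b f x *\<^sub>R b)"

definition divergence :: "('a::euclidean_space \<Rightarrow> 'a) \<Rightarrow> 'a \<Rightarrow> real" where
  "divergence F x = (\<Sum>b\<in>Basis. frechet_derivative F (at x) b \<bullet> b)"

text \<open>Functions of class \<open>C\<^sup>k\<close> up to the boundary of an open set \<open>\<Omega>\<close>: all partial derivatives of
  order at most \<open>k\<close> exist in \<open>\<Omega>\<close> and extend continuously to the closure. In the Hoelder class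
  the derivatives of order \<open>k\<close> are in addition globally \<open>\<gamma>\<close>-Hoelder in \<open>\<Omega>\<close>.\<close>

definition Ck_closure :: "nat \<Rightarrow> 'a::euclidean_space set \<Rightarrow> ('a \<Rightarrow> real) \<Rightarrow> bool" where
  "Ck_closure k \<Omega> f \<longleftrightarrow>
     continuous_on (closure \<Omega>) f \<and>
     (\<forall>bs. set bs \<subseteq> Basis \<and> length bs < k \<longrightarrow> (\<forall>x\<in>\<Omega>. iter_partial bs f differentiable (at x))) \<and>
     (\<forall>bs. set bs \<subseteq> Basis \<and> length bs \<le> k \<longrightarrow>
        (\<exists>g. continuous_on (closure \<Omega>) g \<and> (\<forall>x\<in>\<Omega>. g x = iter_partial bs f x)))"

definition Holder_closure :: "nat \<Rightarrow> real \<Rightarrow> 'a::euclidean_space set \<Rightarrow> ('a \<Rightarrow> real) \<Rightarrow> bool" where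
  "Holder_closure k \<gamma> \<Omega> f \<longleftrightarrow>
     Ck_closure k \<Omega> f \<and>
     (\<forall>bs. set bs \<subseteq> Basis \<and> length bs = k \<longrightarrow>
        (\<exists>L. \<forall>x\<in>\<Omega>. \<forall>y\<in>\<Omega>. \<bar>iter_partial bs f x - iter_partial bs f y\<bar> \<le> L * dist x y powr \<gamma>))"

definition smooth_closure :: "'a::euclidean_space set \<Rightarrow> ('a \<Rightarrow> real) \<Rightarrow> bool" where
  "smooth_closure \<Omega> f \<longleftrightarrow> (\<forall>k. Ck_closure k \<Omega> f)"

text \<open>Near each boundary point, \<open>\<Omega>\<close> is the region below the graph of a \<open>C\<^sup>k\<^sup>,\<^sup>\<gamma>\<close> function over a
  hyperplane. The unit vector \<open>e\<close> plays the role of the last coordinate direction after a rotation,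
  \<open>y - (y \<bullet> e) *\<^sub>R e\<close> is the projection of \<open>y\<close> to the hyperplane orthogonal to \<open>e\<close>, and only the
  values of \<open>g\<close> on that hyperplane are used.\<close>

definition Holder_boundary :: "nat \<Rightarrow> real \<Rightarrow> 'a::euclidean_space set \<Rightarrow> bool" where
  "Holder_boundary k \<gamma> \<Omega> \<longleftrightarrow>
     (\<forall>x\<in>frontier \<Omega>. \<exists>e g \<delta>. norm e = 1 \<and> \<delta> > 0 \<and>
        Holder_closure k \<gamma> (ball x \<delta>) (\<lambda>y. g (y - (y \<bullet> e) *\<^sub>R e)) \<and>
        \<Omega> \<inter> ball x \<delta> = {y \<in> ball x \<delta>. y \<bullet> e < g (y - (y \<bullet> e) *\<^sub>R e)})"

text \<open>The outer unit normal is \<open>D\<phi> / |D\<phi>|\<close> for any local \<open>C\<^sup>1\<close> defining function \<open>\<phi>\<close>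
  (negative inside, nonvanishing gradient); it does not depend on \<open>\<phi>\<close>.\<close>

definition outer_normal :: "'a::euclidean_space set \<Rightarrow> 'a \<Rightarrow> 'a" where
  "outer_normal \<Omega> x = (THE \<nu>. \<exists>V \<phi> G. open V \<and> x \<in> V \<and> continuous_on V G \<and>
      (\<forall>y\<in>V. (GDERIV \<phi> y :> G y) \<and> G y \<noteq> 0) \<and>
      \<Omega> \<inter> V = {y \<in> V. \<phi> y < 0} \<and> \<nu> = sgn (G x))"

text \<open>For a field \<open>F\<close> given only on the hypersurface \<open>S\<close> with unit normal \<open>\<nu>\<close>, a derivative of \<open>F\<close>
  relative to \<open>S\<close> is determined on tangent vectors only. Subtracting the normal contribution from
  its trace leaves the trace over the tangent space, which is independent of the choice.\<close>

definition tangential_div ::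
  "'a::euclidean_space set \<Rightarrow> ('a \<Rightarrow> 'a) \<Rightarrow> ('a \<Rightarrow> 'a) \<Rightarrow> 'a \<Rightarrow> real" where
  "tangential_div S \<nu> F x =
     (let D = frechet_derivative F (at x within S)
      in (\<Sum>b\<in>Basis. D b \<bullet> b) - D (\<nu> x) \<bullet> \<nu> x)"

definition mean_curvature :: "'a::euclidean_space set \<Rightarrow> 'a \<Rightarrow> real" where
  "mean_curvature \<Omega> x =
     - (1 / (real DIM('a) - 1)) *
       tangential_div (frontier \<Omega>) (outer_normal \<Omega>) (outer_normal \<Omega>) x"

text \<open>The gradient on the boundary is the limit of the gradient from inside \<open>\<Omega>\<close>.\<close>

definition normal_deriv :: "'a::euclidean_space set \<Rightarrow> ('a \<Rightarrow> real) \<Rightarrow> 'a \<Rightarrow> real" where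
  "normal_deriv \<Omega> u x = Lim (at x within \<Omega>) (grad u) \<bullet> outer_normal \<Omega> x"

definition translator_eq :: "'a::euclidean_space set \<Rightarrow> ('a \<Rightarrow> real) \<Rightarrow> bool" where
  "translator_eq \<Omega> u \<longleftrightarrow>
     (\<forall>x\<in>\<Omega>. - divergence (\<lambda>y. (1 / sqrt (1 + (norm (grad u y))\<^sup>2)) *\<^sub>R grad u y) x
             = 1 / sqrt (1 + (norm (grad u x))\<^sup>2))"

definition overdetermined ::
  "'a::euclidean_space set \<Rightarrow> ('a \<Rightarrow> real) \<Rightarrow> real \<Rightarrow> real \<Rightarrow> real \<Rightarrow> bool" where
  "overdetermined \<Omega> u a \<Gamma> C \<longleftrightarrow>
     translator_eq \<Omega> u \<and>
     (\<forall>x\<in>frontier \<Omega>. u x = a) \<and>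
     (\<forall>x\<in>frontier \<Omega>. normal_deriv \<Omega> u x = \<Gamma> * mean_curvature \<Omega> x + C)"

definition annulus :: "real \<Rightarrow> real \<Rightarrow> 'a::euclidean_space set" where
  "annulus r R = ball 0 R - closure (ball 0 r)"

definition profile :: "nat \<Rightarrow> real \<Rightarrow> real \<Rightarrow> (real \<Rightarrow> real) \<Rightarrow> bool" where
  "profile n r \<alpha> p \<longleftrightarrow>
     p r = \<alpha> \<and>
     (\<forall>\<rho>\<ge>r. (p has_real_derivative
                - (1 + (p \<rho>)\<^sup>2) * (1 + (real n - 1) / \<rho> * p \<rho>)) (at \<rho> within {r..}))"

end

theory Submission
  imports Defs
begin

text \<open>
  For \<open>u(x) = U(|x|)\<close> with slope \<open>p = U'\<close> one has \<open>Du = p x/|x|\<close>, and the translator equation becomes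
  \<open>(p/w)' + (n-1)/\<rho> \<cdot> p/w = -1/w\<close> with \<open>w = (1 + p\<^sup>2)\<^sup>1\<^sup>/\<^sup>2\<close>; since \<open>(p/w)' = p'/w\<^sup>3\<close>, this is exactly the
  profile equation. So every primitive of the profile gives a solution on every annulus, and only
  the boundary conditions remain (\<open>profile_translator_eq\<close>).

  The right-hand side of the profile equation vanishes on the line \<open>p = -\<rho>/(n-1)\<close>, and the profile
  can only cross this line upwards. Hence it stays above the line and is decreasing, so it is
  bounded on bounded intervals and exists on the whole half-line (\<open>profile_exists\<close>).
  Constant boundary values mean \<open>U(R) = U(r)\<close>, that is \<open>\<integral> p = 0\<close> over \<open>[r, R]\<close>. As \<open>p\<close> starts at
  \<open>\<alpha> > 0\<close>, decreases, and becomes negative, the primitive first rises and then falls to \<open>-\<infinity>\<close>,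
  which gives exactly one such \<open>R\<close> (\<open>profile_radius\<close>).

  The Neumann condition is two linear equations, \<open>-\<alpha> = \<Gamma>/r + C\<close> on the inner sphere and
  \<open>p(R) = -\<Gamma>/R + C\<close> on the outer one. They determine \<open>\<Gamma>\<close> and \<open>C\<close>, with
  \<open>\<Gamma> (1/r + 1/R) = -(\<alpha> + p(R))\<close>, so the sign of \<open>\<Gamma>\<close> is decided by comparing \<open>|p(R)|\<close> with \<open>\<alpha>\<close>.
  For this, the quantity \<open>ln (1 + p\<^sup>2)/2 + U\<close> has derivative \<open>-(n-1) p\<^sup>2/\<rho>\<close> and so decreases; equal
  values of \<open>U\<close> at the ends force \<open>p(R)\<^sup>2 < \<alpha>\<^sup>2\<close> (\<open>profile_outer_slope\<close>).

  Regularity is algebraic. The functions \<open>x \<bullet> c\<close>, \<open>1/|x|\<close>, \<open>p(|x|)\<close> and \<open>U(|x|)\<close> generate an algebra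
  that is closed under partial derivatives, by the profile equation, and whose members are
  Lipschitz up to the boundary of the annulus. Therefore all partial derivatives of \<open>u\<close> extend
  continuously and are Hoelder (locale \<open>smooth_generators\<close>). The same device shows that
  spheres are locally Hoelder graphs.
\<close>

section \<open>Initial value problems with a Lipschitz right-hand side\<close>

text \<open>
  The weight \<open>exp (-2Lt)\<close> turns the differential inequality \<open>(d\<^sup>2)' \<le> 2L d\<^sup>2\<close> into monotonicity, and
  a nonnegative decreasing function that starts at zero stays zero.
\<close>

lemma gronwall_zero:
  fixes d d' :: "real \<Rightarrow> real"
  assumes der: "\<And>t. t \<in> {a..b} \<Longrightarrow> (d has_real_derivative d' t) (at t within {a..b})"
    and bound: "\<And>t. t \<in> {a..b} \<Longrightarrow> \<bar>d' t\<bar> \<le> L * \<bar>d t\<bar>"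
    and init: "d a = 0" and x: "x \<in> {a..b}"
  shows "d x = 0"
proof -
  define g where "g = (\<lambda>t. (d t)\<^sup>2 * exp (- 2 * L * t))"
  have "g x \<le> g a"
  proof (rule DERIV_nonpos_imp_decreasing_open[of a x g])
    show "a \<le> x" using x by simp
    show "continuous_on {a..x} g"
      unfolding g_def using der x
      by (intro continuous_intros continuous_on_subset[OF DERIV_continuous_on[OF der]]) auto
  next
    fix t assume t: "a < t" "t < x"
    have D: "(d has_real_derivative d' t) (at t)"
      using der[of t] t x by (simp add: at_within_Icc_at)
    have "(g has_real_derivative
            exp (- 2 * L * t) * (2 * (d t * d' t - L * (d t)\<^sup>2))) (at t)"
      unfolding g_def
      by (rule derivative_eq_intros D refl | simp)+ (simp add: algebra_simps power2_eq_square)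
    moreover have "d t * d' t \<le> L * (d t)\<^sup>2"
    proof -
      have "d t * d' t \<le> \<bar>d t\<bar> * \<bar>d' t\<bar>"
        by (metis abs_ge_self abs_mult)
      also have "\<dots> \<le> \<bar>d t\<bar> * (L * \<bar>d t\<bar>)"
        using bound[of t] t x by (intro mult_left_mono) auto
      finally show ?thesis
        by (simp add: power2_eq_square mult.left_commute)
    qed
    ultimately show "\<exists>y. (g has_real_derivative y) (at t) \<and> y \<le> 0"
      by (intro exI[of _ "exp (- 2 * L * t) * (2 * (d t * d' t - L * (d t)\<^sup>2))"])
         (auto simp: mult_le_0_iff)
  qed
  then show ?thesis
    using init by (simp add: g_def mult_le_0_iff)
qed

text \<open>
  The Lipschitz bound is only asked along the two solutions, so that equations whose right-hand
  side is merely locally Lipschitz are covered as well.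
\<close>

lemma ode_solutions_agree:
  fixes p q :: "real \<Rightarrow> real"
  assumes p: "\<And>t. t \<in> {a..b} \<Longrightarrow> (p has_real_derivative f t (p t)) (at t within {a..b})"
    and q: "\<And>t. t \<in> {a..b} \<Longrightarrow> (q has_real_derivative f t (q t)) (at t within {a..b})"
    and lip: "\<And>t. t \<in> {a..b} \<Longrightarrow> \<bar>f t (p t) - f t (q t)\<bar> \<le> L * \<bar>p t - q t\<bar>"
    and init: "p a = q a" and x: "x \<in> {a..b}"
  shows "p x = q x"
  using gronwall_zero[of a b "\<lambda>t. p t - q t" "\<lambda>t. f t (p t) - f t (q t)" L x]
    DERIV_diff[OF p q] lip init x by simp

text \<open>
  Picard iteration as a single contraction on the whole interval: the unknown is
  \<open>w(t) = exp (-2Lt) p(t)\<close>, and in the supremum norm of \<open>w\<close> the integral operator has Lipschitz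
  constant at most \<open>1/2\<close> whatever the length of the interval.
\<close>

lemma picard_compact:
  fixes f :: "real \<Rightarrow> real \<Rightarrow> real"
  assumes ab: "a \<le> b" and L: "L > 0"
    and cont: "continuous_on ({a..b} \<times> UNIV) (\<lambda>(t, y). f t y)"
    and lip: "\<And>t y z. t \<in> {a..b} \<Longrightarrow> \<bar>f t y - f t z\<bar> \<le> L * \<bar>y - z\<bar>"
  shows "\<exists>p. p a = \<alpha> \<and> (\<forall>t\<in>{a..b}. (p has_real_derivative f t (p t)) (at t within {a..b}))"
proof -
  \<comment> \<open>Precomposing with \<open>c\<close> extends functions on the interval to bounded continuous ones on the line.\<close>
  define c where "c = (\<lambda>t. max a (min b t))"
  have c_in: "c t \<in> {a..b}" for t using ab by (auto simp: c_def)
  have c_id: "c t = t" if "t \<in> {a..b}" for t using that by (auto simp: c_def)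
  define F where "F = (\<lambda>(w :: real \<Rightarrow>\<^sub>C real) s. f s (exp (2 * L * s) * w s))"
  define I where "I = (\<lambda>w t. exp (- 2 * L * t) * (\<alpha> + integral {a..t} (F w)))"
  have contF: "continuous_on {a..b} (F w)" for w
    unfolding F_def
    by (rule continuous_on_compose2[OF cont, of _ "\<lambda>s. (s, exp (2 * L * s) * w s)", simplified])
       (auto intro!: continuous_intros)
  have intF: "F w integrable_on {a..t}" if "t \<in> {a..b}" for w t
    by (rule integrable_continuous_real, rule continuous_on_subset[OF contF]) (use that in auto)
  have derI: "((\<lambda>t. \<alpha> + integral {a..t} (F w)) has_real_derivative F w t) (at t within {a..b})"
    if "t \<in> {a..b}" for w t
    using DERIV_add[OF DERIV_const integral_has_real_derivative[OF contF that]] by simp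
  have contI: "continuous_on {a..b} (I w)" for w
    unfolding I_def
    by (intro continuous_intros DERIV_continuous_on[OF derI])
  have bcont: "(\<lambda>t. I w (c t)) \<in> bcontfun" for w
  proof -
    have "continuous_on UNIV (\<lambda>t. I w (c t))"
      by (rule continuous_on_compose2[OF contI])
         (use ab in \<open>auto simp: c_def intro!: continuous_intros\<close>)
    moreover have "bounded (range (\<lambda>t. I w (c t)))"
    proof (rule bounded_subset)
      show "bounded (I w ` {a..b})"
        by (intro compact_imp_bounded compact_continuous_image contI) simp
      show "range (\<lambda>t. I w (c t)) \<subseteq> I w ` {a..b}" using c_in by blast
    qed
    ultimately show ?thesis by (simp add: bcontfun_def)
  qed
  define \<Phi> where "\<Phi> = (\<lambda>w. Bcontfun (\<lambda>t. I w (c t)))"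
  have \<Phi>_apply: "apply_bcontfun (\<Phi> w) t = I w (c t)" for w t
    unfolding \<Phi>_def using bcont by (simp add: Bcontfun_inverse)
  have contr: "dist (\<Phi> v) (\<Phi> w) \<le> 1/2 * dist v w" for v w
  proof (rule dist_bound)
    fix t
    let ?D = "dist v w"
    let ?\<tau> = "c t"
    have \<tau>: "?\<tau> \<in> {a..b}" by (rule c_in)
    have expint: "((\<lambda>s. L * (exp (2 * L * s) * ?D)) has_integral
        (exp (2 * L * ?\<tau>) * ?D / 2 - exp (2 * L * a) * ?D / 2)) {a..?\<tau>}"
    proof (rule fundamental_theorem_of_calculus)
      show "a \<le> ?\<tau>" using \<tau> by simp
      fix s
      show "((\<lambda>s. exp (2 * L * s) * ?D / 2) has_vector_derivative L * (exp (2 * L * s) * ?D))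
              (at s within {a..?\<tau>})"
        unfolding has_real_derivative_iff_has_vector_derivative[symmetric]
        by (rule derivative_eq_intros refl | simp)+
    qed
    have "\<bar>integral {a..?\<tau>} (F v) - integral {a..?\<tau>} (F w)\<bar>
          = norm (integral {a..?\<tau>} (\<lambda>s. F v s - F w s))"
      using \<tau> by (simp add: integral_diff intF)
    also have "\<dots> \<le> integral {a..?\<tau>} (\<lambda>s. L * (exp (2 * L * s) * ?D))"
    proof (rule integral_norm_bound_integral)
      show "(\<lambda>s. F v s - F w s) integrable_on {a..?\<tau>}"
        using \<tau> by (intro integrable_diff intF)
      show "(\<lambda>s. L * (exp (2 * L * s) * ?D)) integrable_on {a..?\<tau>}"
        using expint by blast
      fix s assume "s \<in> {a..?\<tau>}"
      then have s: "s \<in> {a..b}" using \<tau> by auto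
      have "\<bar>F v s - F w s\<bar> \<le> L * \<bar>exp (2 * L * s) * v s - exp (2 * L * s) * w s\<bar>"
        unfolding F_def by (rule lip[OF s])
      also have "\<bar>exp (2 * L * s) * v s - exp (2 * L * s) * w s\<bar> = exp (2 * L * s) * dist (v s) (w s)"
        by (simp add: dist_real_def abs_mult flip: right_diff_distrib)
      also have "L * \<dots> \<le> L * (exp (2 * L * s) * ?D)"
        using L by (intro mult_left_mono dist_bounded) auto
      finally show "norm (F v s - F w s) \<le> L * (exp (2 * L * s) * ?D)" by simp
    qed
    also have "\<dots> = exp (2 * L * ?\<tau>) * ?D / 2 - exp (2 * L * a) * ?D / 2"
      using expint by (rule integral_unique)
    also have "\<dots> \<le> exp (2 * L * ?\<tau>) * ?D / 2" by simp
    finally have *: "\<bar>integral {a..?\<tau>} (F v) - integral {a..?\<tau>} (F w)\<bar> \<le> exp (2 * L * ?\<tau>) * ?D / 2" .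
    have "dist (\<Phi> v t) (\<Phi> w t)
        = exp (- 2 * L * ?\<tau>) * \<bar>integral {a..?\<tau>} (F v) - integral {a..?\<tau>} (F w)\<bar>"
      unfolding \<Phi>_apply I_def dist_real_def right_diff_distrib[symmetric] abs_mult by simp
    also have "\<dots> \<le> exp (- 2 * L * ?\<tau>) * (exp (2 * L * ?\<tau>) * ?D / 2)"
      using * by (intro mult_left_mono) auto
    also have "\<dots> = 1/2 * ?D" by (simp add: exp_minus field_simps)
    finally show "dist (\<Phi> v t) (\<Phi> w t) \<le> 1/2 * ?D" .
  qed
  obtain w where w: "\<Phi> w = w"
    using banach_fix_type[of "1/2" \<Phi>] contr by auto
  define p where "p = (\<lambda>t. \<alpha> + integral {a..t} (F w))"
  have p_w: "exp (2 * L * t) * w t = p t" if "t \<in> {a..b}" for t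
  proof -
    have "w t = I w (c t)" using \<Phi>_apply[of w t] w by simp
    then show ?thesis using that by (simp add: I_def p_def c_id exp_minus)
  qed
  have "(p has_real_derivative f t (p t)) (at t within {a..b})" if "t \<in> {a..b}" for t
    using derI[OF that, of w] p_w[OF that] by (simp add: p_def F_def)
  moreover have "p a = \<alpha>" by (simp add: p_def)
  ultimately show ?thesis by blast
qed

text \<open>
  Solutions on \<open>[a, b]\<close> for different \<open>b\<close> agree where both are defined, so they glue; the value at
  \<open>t\<close> is taken from the solution on \<open>[a, t + 1]\<close>, which also covers a neighbourhood of \<open>t\<close>.
\<close>

lemma picard_global:
  fixes f :: "real \<Rightarrow> real \<Rightarrow> real"
  assumes cont: "continuous_on ({a..} \<times> UNIV) (\<lambda>(t, y). f t y)"
    and lip: "\<And>b. \<exists>L>0. \<forall>t\<in>{a..b}. \<forall>y z. \<bar>f t y - f t z\<bar> \<le> L * \<bar>y - z\<bar>"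
  shows "\<exists>p. p a = \<alpha> \<and> (\<forall>t\<ge>a. (p has_real_derivative f t (p t)) (at t within {a..}))"
proof -
  have "\<exists>p. p a = \<alpha> \<and> (\<forall>t\<in>{a..b}. (p has_real_derivative f t (p t)) (at t within {a..b}))"
    if b: "a \<le> b" for b
  proof -
    obtain L where "L > 0" "\<forall>t\<in>{a..b}. \<forall>y z. \<bar>f t y - f t z\<bar> \<le> L * \<bar>y - z\<bar>"
      using lip by blast
    then show ?thesis
      by (intro picard_compact[OF b, of L] continuous_on_subset[OF cont]) auto
  qed
  then obtain P where P0: "\<And>b. a \<le> b \<Longrightarrow> P b a = \<alpha>"
    and PD: "\<And>b t. a \<le> b \<Longrightarrow> t \<in> {a..b} \<Longrightarrow>
              (P b has_real_derivative f t (P b t)) (at t within {a..b})"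
    by metis
  have agree: "P b t = P b' t" if "t \<in> {a..b}" "b \<le> b'" for b b' t
  proof -
    obtain L where L: "\<forall>t\<in>{a..b}. \<forall>y z. \<bar>f t y - f t z\<bar> \<le> L * \<bar>y - z\<bar>"
      using lip by blast
    show ?thesis
    proof (rule ode_solutions_agree[of a b "P b" f "P b'" L t])
      show "(P b' has_real_derivative f s (P b' s)) (at s within {a..b})" if "s \<in> {a..b}" for s
        using that \<open>b \<le> b'\<close> by (intro DERIV_subset[OF PD]) auto
      show "(P b has_real_derivative f s (P b s)) (at s within {a..b})" if "s \<in> {a..b}" for s
        using that by (intro PD) auto
      show "P b a = P b' a" using that by (simp add: P0)
    qed (use that L in blast)+
  qed
  define p where "p = (\<lambda>t. P (t + 1) t)"
  have "(p has_real_derivative f t (p t)) (at t within {a..})" if t: "t \<ge> a" for t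
  proof -
    have eq: "p s = P (t + 1) s" if "s \<ge> a" "s < t + 1" for s
    proof (cases "s \<le> t")
      case True
      then show ?thesis unfolding p_def by (intro agree) (use that in auto)
    next
      case False
      then show ?thesis unfolding p_def by (intro agree[symmetric]) (use that in auto)
    qed
    have "(P (t + 1) has_real_derivative f t (P (t + 1) t)) (at t within {a..t + 1})"
      using t by (intro PD) auto
    moreover have "at t within {a..t + 1} = at t within {a..}"
      by (rule at_within_nhd[of t "{t - 1<..<t + 1}"]) (use t in auto)
    ultimately have "(P (t + 1) has_real_derivative f t (P (t + 1) t)) (at t within {a..})"
      by simp
    then have "(p has_real_derivative f t (P (t + 1) t)) (at t within {a..})"
    proof (rule has_field_derivative_transform_within[where d = 1])
      fix s assume s: "s \<in> {a..}" "dist s t < 1"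
      then have "s \<ge> a" "s < t + 1" by (simp_all add: dist_real_def abs_less_iff)
      then show "P (t + 1) s = p s" by (rule eq[symmetric])
    qed (use t in simp_all)
    then show ?thesis using eq[of t] t by simp
  qed
  moreover have "p a = \<alpha>" by (simp add: p_def P0)
  ultimately show ?thesis by blast
qed

section \<open>The slope profile and the outer radius\<close>

text \<open>
  The field is a cubic polynomial in \<open>y\<close> with coefficients bounded for \<open>\<rho> \<ge> r\<close>; dividing the
  difference of two values by \<open>y - z\<close> leaves a polynomial that is bounded on \<open>[-M, M]\<close>.
\<close>

lemma profile_field_lipschitz:
  fixes k r \<rho> M y z :: real
  assumes "k \<ge> 0" "r > 0" "\<rho> \<ge> r" "\<bar>y\<bar> \<le> M" "\<bar>z\<bar> \<le> M"
  shows "\<bar>- (1 + y\<^sup>2) * (1 + k / \<rho> * y) - - (1 + z\<^sup>2) * (1 + k / \<rho> * z)\<bar>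
           \<le> (2 * M + k / r + 3 * (k / r) * M\<^sup>2) * \<bar>y - z\<bar>"
proof -
  have M: "M \<ge> 0" using assms by linarith
  have k: "0 \<le> k / \<rho>" "k / \<rho> \<le> k / r"
    using assms by (auto intro!: divide_left_mono mult_pos_pos)
  have sq: "\<bar>y\<^sup>2 + y * z + z\<^sup>2\<bar> \<le> 3 * M\<^sup>2"
  proof -
    have "\<bar>u * v\<bar> \<le> M\<^sup>2" if "\<bar>u\<bar> \<le> M" "\<bar>v\<bar> \<le> M" for u v
      unfolding abs_mult power2_eq_square using that M by (intro mult_mono) auto
    from this[of y y] this[of z z] this[of y z] assms
    have "\<bar>y\<^sup>2\<bar> \<le> M\<^sup>2" "\<bar>z\<^sup>2\<bar> \<le> M\<^sup>2" "\<bar>y * z\<bar> \<le> M\<^sup>2"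
      by (auto simp: power2_eq_square)
    then show ?thesis by linarith
  qed
  have "\<bar>(y + z) + k / \<rho> + k / \<rho> * (y\<^sup>2 + y * z + z\<^sup>2)\<bar>
      \<le> \<bar>y + z\<bar> + \<bar>k / \<rho>\<bar> + \<bar>k / \<rho> * (y\<^sup>2 + y * z + z\<^sup>2)\<bar>"
    by (intro order_trans[OF abs_triangle_ineq] add_right_mono abs_triangle_ineq)
  also have "\<dots> \<le> 2 * M + k / r + k / r * (3 * M\<^sup>2)"
    unfolding abs_mult using assms k sq
    by (intro add_mono mult_mono) auto
  finally have bound: "\<bar>(y + z) + k / \<rho> + k / \<rho> * (y\<^sup>2 + y * z + z\<^sup>2)\<bar> \<le> 2 * M + k / r + 3 * (k / r) * M\<^sup>2"
    by (simp add: mult_ac)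
  have factor: "- (1 + y\<^sup>2) * (1 + c * y) - - (1 + z\<^sup>2) * (1 + c * z)
      = - ((y + z) + c + c * (y\<^sup>2 + y * z + z\<^sup>2)) * (y - z)" for c
    by (simp add: algebra_simps power2_eq_square)
  show ?thesis
    unfolding factor abs_mult abs_minus_cancel using bound by (intro mult_right_mono) simp_all
qed

text \<open>
  A function with a negative value at \<open>x\<close> would be nondecreasing from its last nonnegative time
  before \<open>x\<close> onwards, which is absurd.
\<close>

lemma nonneg_barrier:
  fixes h h' :: "real \<Rightarrow> real"
  assumes der: "\<And>t. t \<ge> a \<Longrightarrow> (h has_real_derivative h' t) (at t within {a..})"
    and "h a \<ge> 0" and pos: "\<And>t. t \<ge> a \<Longrightarrow> h t < 0 \<Longrightarrow> h' t \<ge> 0" and "x \<ge> a"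
  shows "h x \<ge> 0"
proof (rule ccontr)
  assume neg: "\<not> h x \<ge> 0"
  have cont: "continuous_on {a..x} h"
    by (rule DERIV_continuous_on[of _ h h'], rule DERIV_subset[OF der]) auto
  define S where "S = {t \<in> {a..x}. h t \<in> {0..}}"
  have "closed S" unfolding S_def
    by (rule continuous_closed_preimage[OF cont, unfolded vimage_def Int_def mem_Collect_eq]) auto
  moreover have "a \<in> S" using assms by (auto simp: S_def)
  moreover have bdd: "bdd_above S" by (auto simp: S_def intro!: bdd_aboveI[of _ x])
  ultimately have c: "Sup S \<in> S" by (intro closed_contains_Sup) auto
  define c where "c = Sup S"
  have "c \<in> S" using c by (simp add: c_def)
  have after: "h t < 0" if "c < t" "t \<le> x" for t
  proof (rule ccontr)
    assume "\<not> h t < 0"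
    then have "t \<in> S" using that \<open>c \<in> S\<close> by (auto simp: S_def)
    then have "t \<le> c" unfolding c_def using bdd by (rule cSup_upper)
    with that show False by simp
  qed
  have "h c \<le> h x"
  proof (rule DERIV_nonneg_imp_increasing_open[of c x h])
    show "c \<le> x" "continuous_on {c..x} h"
      using \<open>c \<in> S\<close> by (auto simp: S_def intro: continuous_on_subset[OF cont])
    fix t assume t: "c < t" "t < x"
    have "t > a" using t \<open>c \<in> S\<close> by (auto simp: S_def)
    then have "(h has_real_derivative h' t) (at t)"
      using der[of t] at_within_interior[of t "{a..}"] by simp
    moreover have "h' t \<ge> 0" using pos[of t] after[of t] t \<open>t > a\<close> by auto
    ultimately show "\<exists>y. (h has_real_derivative y) (at t) \<and> 0 \<le> y" by blast
  qed
  with neg \<open>c \<in> S\<close> show False by (auto simp: S_def)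
qed

text \<open>
  The cubic field is not globally Lipschitz. Clamping the argument to \<open>[-\<rho>/(n-1), \<alpha>]\<close> makes it so on
  compact time intervals, and both ends of this strip are barriers: the clamped field is never
  positive, and it vanishes below the strip, whose lower end moves down. Hence the solution of the
  clamped problem stays in the strip and solves the original equation. The lower bound is kept in
  the conclusion because it is what makes profiles decreasing.
\<close>

lemma profile_exists:
  assumes n: "n \<ge> 2" and r: "r > 0" and \<alpha>: "\<alpha> > 0"
  shows "\<exists>p. profile n r \<alpha> p \<and> (\<forall>\<rho>\<ge>r. - \<rho> / (real n - 1) \<le> p \<rho> \<and> p \<rho> \<le> \<alpha>)"
proof -
  define k where "k = real n - 1"
  have k: "k > 0" using n by (simp add: k_def)
  define cl where "cl = (\<lambda>\<rho> y. max (- \<rho> / k) (min \<alpha> y))"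
  define f where "f = (\<lambda>\<rho> y. - (1 + (cl \<rho> y)\<^sup>2) * (1 + k / \<rho> * cl \<rho> y))"
  have cl_lip: "\<bar>cl \<rho> y - cl \<rho> z\<bar> \<le> \<bar>y - z\<bar>" for \<rho> y z
    unfolding cl_def by (auto simp: max_def min_def)
  have "\<exists>p. p r = \<alpha> \<and> (\<forall>t\<ge>r. (p has_real_derivative f t (p t)) (at t within {r..}))"
  proof (rule picard_global)
    show "continuous_on ({r..} \<times> UNIV) (\<lambda>(t, y). f t y)"
      unfolding f_def cl_def case_prod_beta using r k by (intro continuous_intros) auto
    fix b
    define M where "M = max \<alpha> (\<bar>b\<bar> / k)"
    have M: "M > 0" using \<alpha> by (simp add: M_def)
    have bnd: "\<bar>cl t y\<bar> \<le> M" if "t \<in> {r..b}" for t y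
    proof -
      have "0 \<le> t / k" "t / k \<le> \<bar>b\<bar> / k"
        using that r k by (auto intro!: divide_right_mono)
      then show ?thesis unfolding cl_def M_def using \<alpha> by (auto simp: max_def min_def)
    qed
    let ?L = "2 * M + k / r + 3 * (k / r) * M\<^sup>2"
    have L: "?L > 0" using M k r by (auto intro!: add_pos_nonneg add_pos_pos)
    have "\<bar>f t y - f t z\<bar> \<le> ?L * \<bar>y - z\<bar>" if "t \<in> {r..b}" for t y z
    proof -
      have "\<bar>f t y - f t z\<bar> \<le> ?L * \<bar>cl t y - cl t z\<bar>"
        unfolding f_def using that k r bnd[OF that] by (intro profile_field_lipschitz) auto
      also have "\<dots> \<le> ?L * \<bar>y - z\<bar>" using L cl_lip by (intro mult_left_mono) auto
      finally show ?thesis .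
    qed
    with L show "\<exists>L>0. \<forall>t\<in>{r..b}. \<forall>y z. \<bar>f t y - f t z\<bar> \<le> L * \<bar>y - z\<bar>" by blast
  qed
  then obtain p where p0: "p r = \<alpha>"
    and pD: "\<And>t. t \<ge> r \<Longrightarrow> (p has_real_derivative f t (p t)) (at t within {r..})"
    by blast
  have f_nonpos: "f t y \<le> 0" if "t \<ge> r" for t y
  proof -
    have "- t / k \<le> cl t y" by (simp add: cl_def)
    then have "0 \<le> 1 + k / t * cl t y" using that r k by (simp add: field_simps)
    then show ?thesis
      unfolding f_def using zero_le_power2[of "cl t y"] by (intro mult_nonpos_nonneg) linarith+
  qed
  have upper: "p t \<le> \<alpha>" if "t \<ge> r" for t
    using nonneg_barrier[of r "\<lambda>t. \<alpha> - p t" "\<lambda>t. - f t (p t)" t]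
      DERIV_diff[OF DERIV_const pD] p0 f_nonpos that by simp
  have lower: "- t / k \<le> p t" if "t \<ge> r" for t
  proof -
    have "0 \<le> p t + t / k"
    proof (rule nonneg_barrier[where a = r and h = "\<lambda>t. p t + t / k" and h' = "\<lambda>t. f t (p t) + 1 / k"])
      show "((\<lambda>t. p t + t / k) has_real_derivative f t (p t) + 1 / k) (at t within {r..})"
        if "r \<le> t" for t
        by (rule derivative_eq_intros pD[OF that] refl | use k in simp)+
      show "0 \<le> p r + r / k" using p0 \<alpha> r k by simp
      show "0 \<le> f t (p t) + 1 / k" if "r \<le> t" "p t + t / k < 0" for t
      proof -
        have "cl t (p t) = - t / k" using that by (auto simp: cl_def)
        then have "f t (p t) = 0" using that r k by (simp add: f_def)
        then show ?thesis using k by simp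
      qed
    qed (rule that)
    then show ?thesis by simp
  qed
  have "f t (p t) = - (1 + (p t)\<^sup>2) * (1 + (real n - 1) / t * p t)" if "t \<ge> r" for t
    using lower[OF that] upper[OF that] by (simp add: f_def cl_def k_def)
  then show ?thesis
    unfolding profile_def using p0 pD lower upper by (intro exI[of _ p]) (simp add: k_def)
qed

text \<open>
  Both solutions are bounded on \<open>[r, \<rho>]\<close> by continuity, and on bounded sets the field is
  Lipschitz.
\<close>

lemma profile_unique:
  assumes n: "n \<ge> 1" and r: "r > 0" and p: "profile n r \<alpha> p" and q: "profile n r \<alpha> q" and \<rho>: "\<rho> \<ge> r"
  shows "q \<rho> = p \<rho>"
proof -
  have D: "(g has_real_derivative - (1 + (g t)\<^sup>2) * (1 + (real n - 1) / t * g t)) (at t within {r..\<rho>})"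
    if "profile n r \<alpha> g" "t \<in> {r..\<rho>}" for g t
    using that by (intro DERIV_subset[where s = "{r..}" and t = "{r..\<rho>}"]) (auto simp: profile_def)
  have bdd: "bounded (g ` {r..\<rho>})" if "profile n r \<alpha> g" for g
    using D[OF that] by (intro compact_imp_bounded compact_continuous_image DERIV_continuous_on) auto
  obtain M where M: "\<And>t. t \<in> {r..\<rho>} \<Longrightarrow> \<bar>p t\<bar> \<le> M \<and> \<bar>q t\<bar> \<le> M"
  proof -
    obtain A B where "\<forall>t\<in>{r..\<rho>}. \<bar>p t\<bar> \<le> A" "\<forall>t\<in>{r..\<rho>}. \<bar>q t\<bar> \<le> B"
      using bdd[OF p] bdd[OF q] unfolding bounded_iff by auto
    then have "\<bar>p t\<bar> \<le> max A B \<and> \<bar>q t\<bar> \<le> max A B" if "t \<in> {r..\<rho>}" for t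
      using that by fastforce
    then show ?thesis using that by blast
  qed
  show ?thesis
  proof (rule ode_solutions_agree[of r \<rho> q "\<lambda>t y. - (1 + y\<^sup>2) * (1 + (real n - 1) / t * y)" p
        "2 * M + (real n - 1) / r + 3 * ((real n - 1) / r) * M\<^sup>2"])
    fix t assume t: "t \<in> {r..\<rho>}"
    show "\<bar>- (1 + (q t)\<^sup>2) * (1 + (real n - 1) / t * q t)
            - - (1 + (p t)\<^sup>2) * (1 + (real n - 1) / t * p t)\<bar>
          \<le> (2 * M + (real n - 1) / r + 3 * ((real n - 1) / r) * M\<^sup>2) * \<bar>q t - p t\<bar>"
      using n r t M[OF t] by (intro profile_field_lipschitz) auto
  qed (use D p q \<rho> in \<open>auto simp: profile_def\<close>)
qed

lemma profile_interior_deriv: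
  assumes "profile n r \<alpha> p" "t > r"
  shows "(p has_real_derivative - (1 + (p t)\<^sup>2) * (1 + (real n - 1) / t * p t)) (at t)"
proof -
  have "(p has_real_derivative - (1 + (p t)\<^sup>2) * (1 + (real n - 1) / t * p t)) (at t within {r..})"
    using assms by (simp add: profile_def)
  moreover have "at t within {r..} = at t"
    using assms by (intro at_within_interior) simp
  ultimately show ?thesis by simp
qed

lemma profile_continuous_on: "profile n r \<alpha> p \<Longrightarrow> continuous_on {r..} p"
  unfolding profile_def by (intro DERIV_continuous_on) auto

lemma profile_primitive_deriv:
  assumes "profile n r \<alpha> p"
  shows "t \<in> {r..b} \<Longrightarrow> ((\<lambda>t. integral {r..t} p) has_real_derivative p t) (at t within {r..b})"
    and "t > r \<Longrightarrow> ((\<lambda>t. integral {r..t} p) has_real_derivative p t) (at t)"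
proof -
  have *: "((\<lambda>t. integral {r..t} p) has_real_derivative p t) (at t within {r..b})" if "t \<in> {r..b}" for t b
    using that by (intro integral_has_real_derivative continuous_on_subset[OF profile_continuous_on[OF assms]]) auto
  then show "t \<in> {r..b} \<Longrightarrow> ((\<lambda>t. integral {r..t} p) has_real_derivative p t) (at t within {r..b})" .
  show "((\<lambda>t. integral {r..t} p) has_real_derivative p t) (at t)" if "t > r"
    using *[of t "t + 1"] that at_within_interior[of t "{r..t + 1}"] by simp
qed

text \<open>
  Two zeros of the primitive beyond \<open>r\<close> would, by Rolle's theorem, give two zeros of the
  decreasing \<open>p\<close> and hence an interval on which \<open>p\<close> vanishes; but \<open>p' = -1\<close> wherever \<open>p = 0\<close>.
  For existence: as long as \<open>p \<ge> 0\<close> one has \<open>p' \<le> -1\<close>, so \<open>p\<close> becomes negative and, being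
  decreasing, stays bounded away from zero, which drives the primitive below zero.
\<close>

lemma profile_radius:
  assumes n: "n \<ge> 2" and r: "r > 0" and \<alpha>: "\<alpha> > 0"
    and p: "profile n r \<alpha> p"
    and lower: "\<And>\<rho>. \<rho> \<ge> r \<Longrightarrow> - \<rho> / (real n - 1) \<le> p \<rho>"
  shows "\<exists>!R. R > r \<and> integral {r..R} p = 0"
proof -
  define k where "k = real n - 1"
  have k: "k > 0" using n by (simp add: k_def)
  have p0: "p r = \<alpha>" using p by (simp add: profile_def)
  have pD': "(p has_real_derivative - (1 + (p t)\<^sup>2) * (1 + k / t * p t)) (at t)"
    if "t > r" for t using profile_interior_deriv[OF p that] by (simp add: k_def)
  have cont: "continuous_on {r..b} p" for b
    by (rule continuous_on_subset[OF profile_continuous_on[OF p]]) auto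
  define F where "F = (\<lambda>t. integral {r..t} p)"
  have FD: "(F has_real_derivative p t) (at t within {r..b})" if "t \<in> {r..b}" for t b
    unfolding F_def by (rule profile_primitive_deriv(1)[OF p that])
  have FD': "(F has_real_derivative p t) (at t)" if "t > r" for t
    unfolding F_def by (rule profile_primitive_deriv(2)[OF p that])
  have contF: "continuous_on {a..b} F" if "r \<le> a" for a b
    by (rule continuous_on_subset[OF DERIV_continuous_on[OF FD, of b]]) (use that in auto)
  have anti: "p t \<le> p s" if "r \<le> s" "s \<le> t" for s t
  proof (rule DERIV_nonpos_imp_decreasing_open[of s t p])
    show "continuous_on {s..t} p" by (rule continuous_on_subset[OF cont[of t]]) (use that in auto)
    fix x assume x: "s < x" "x < t"
    have "0 \<le> 1 + k / x * p x" using lower[of x] x that r k by (simp add: k_def field_simps)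
    then have "- (1 + (p x)\<^sup>2) * (1 + k / x * p x) \<le> 0"
      using zero_le_power2[of "p x"] by (intro mult_nonpos_nonneg) linarith+
    then show "\<exists>y. (p has_real_derivative y) (at x) \<and> y \<le> 0"
      using pD'[of x] x that by auto
  qed (use that in auto)
  have F0: "F r = 0" by (simp add: F_def)
  have rolle: "\<exists>c. a < c \<and> c < b \<and> p c = 0" if "r \<le> a" "a < b" "F a = F b" for a b
  proof -
    have "\<exists>z. a < z \<and> z < b \<and> (\<lambda>h. p z * h) = (\<lambda>h. 0)"
      using that FD' contF
      by (intro Rolle_deriv[of a b F "\<lambda>z h. p z * h"]) (auto simp: has_field_derivative_def)
    then show ?thesis by (metis mult_cancel_left1 zero_neq_one)
  qed
  have unique: "False" if R: "r < R1" "R1 < R2" "F R1 = 0" "F R2 = 0" for R1 R2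
  proof -
    obtain c1 where c1: "r < c1" "c1 < R1" "p c1 = 0" using rolle[of r R1] R F0 by auto
    obtain c2 where c2: "R1 < c2" "c2 < R2" "p c2 = 0" using rolle[of R1 R2] R by auto
    have zero: "p t = 0" if "t \<in> {c1..c2}" for t
    proof -
      have "p t \<le> p c1" using that c1 by (intro anti) auto
      moreover have "p c2 \<le> p t" using that c1 by (intro anti) auto
      ultimately show ?thesis using c1 c2 by simp
    qed
    have "((\<lambda>_. 0) has_real_derivative - (1 + (p R1)\<^sup>2) * (1 + k / R1 * p R1)) (at R1)"
    proof (rule has_field_derivative_transform_within_open)
      show "(p has_real_derivative - (1 + (p R1)\<^sup>2) * (1 + k / R1 * p R1)) (at R1)"
        using R by (intro pD') simp
      show "p t = 0" if "t \<in> {c1<..<c2}" for t using that by (intro zero) simp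
    qed (use c1 c2 in simp_all)
    then have "- (1 + (p R1)\<^sup>2) * (1 + k / R1 * p R1) = 0"
      by (rule DERIV_unique) simp
    moreover have "p R1 = 0" using c1 c2 by (intro zero) simp
    ultimately show False by simp
  qed
  have "\<exists>x1>r. p x1 < 0"
  proof (rule ccontr)
    assume neg: "\<not> (\<exists>x1>r. p x1 < 0)"
    have nonneg: "p x \<ge> 0" if "x > r" for x using neg that by force
    \<comment> \<open>A slope of at most \<open>-1\<close> takes \<open>p\<close> from \<open>\<alpha>\<close> down to at most \<open>-1\<close> on \<open>[r, b]\<close>.\<close>
    define b where "b = r + \<alpha> + 1"
    have "p b + b \<le> p r + r"
    proof (rule DERIV_nonpos_imp_decreasing_open[of r b "\<lambda>x. p x + x"])
      show "continuous_on {r..b} (\<lambda>x. p x + x)" by (intro continuous_intros cont)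
      fix x assume x: "r < x" "x < b"
      have "((\<lambda>x. p x + x) has_real_derivative - (1 + (p x)\<^sup>2) * (1 + k / x * p x) + 1) (at x)"
        by (intro DERIV_add pD' DERIV_ident x)
      moreover have "1 * 1 \<le> (1 + (p x)\<^sup>2) * (1 + k / x * p x)"
        using nonneg[of x] x k r by (intro mult_mono) auto
      then have "- (1 + (p x)\<^sup>2) * (1 + k / x * p x) + 1 \<le> 0"
        unfolding mult_minus_left by simp
      ultimately show "\<exists>y. ((\<lambda>x. p x + x) has_real_derivative y) (at x) \<and> y \<le> 0" by blast
    qed (use \<alpha> in \<open>auto simp: b_def\<close>)
    then have "p b < 0" using p0 by (simp add: b_def)
    with nonneg[of b] \<alpha> show False by (simp add: b_def)
  qed
  then obtain x1 where x1: "x1 > r" "p x1 < 0" by blast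
  obtain x0 where x0: "x0 > r" "F x0 > 0"
  proof -
    have "(F has_real_derivative p r) (at r within {r..r + 1})" by (rule FD) simp
    then obtain d where d: "d > 0" "\<And>h. 0 < h \<Longrightarrow> r + h \<in> {r..r + 1} \<Longrightarrow> h < d \<Longrightarrow> F r < F (r + h)"
      using has_real_derivative_pos_inc_right[of F "p r" r "{r..r + 1}"] p0 \<alpha> by auto
    show ?thesis
      using that[of "r + min 1 (d / 2)"] d(2)[of "min 1 (d / 2)"] d(1) F0 by auto
  qed
  obtain x2 where x2: "x2 \<ge> x0" "F x2 \<le> 0"
  proof -
    define m where "m = max x1 x0"
    \<comment> \<open>From \<open>m\<close> on, \<open>F\<close> falls at least at the rate \<open>-p x1\<close>, so by \<open>x2\<close> it has lost at least \<open>\<bar>F m\<bar>\<close>.\<close>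
    define x2 where "x2 = m + \<bar>F m\<bar> / (- p x1)"
    have "m \<le> x2" using x1 by (simp add: x2_def divide_nonneg_neg)
    have "F x2 - p x1 * x2 \<le> F m - p x1 * m"
    proof (rule DERIV_nonpos_imp_decreasing_open[of m x2 "\<lambda>x. F x - p x1 * x"])
      show "continuous_on {m..x2} (\<lambda>x. F x - p x1 * x)"
        using x1 by (intro continuous_intros contF) (auto simp: m_def)
      fix x assume x: "m < x" "x < x2"
      have "((\<lambda>x. F x - p x1 * x) has_real_derivative p x - p x1) (at x)"
        by (rule derivative_eq_intros FD' refl | use x x1 in \<open>simp add: m_def\<close>)+
      moreover have "p x \<le> p x1" using anti[of x1 x] x x1 by (simp add: m_def)
      then have "p x - p x1 \<le> 0" by simp
      ultimately show "\<exists>y. ((\<lambda>x. F x - p x1 * x) has_real_derivative y) (at x) \<and> y \<le> 0" by blast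
    qed (rule \<open>m \<le> x2\<close>)
    then have "F x2 \<le> F m + p x1 * (x2 - m)" by (simp add: algebra_simps)
    also have "p x1 * (x2 - m) = - \<bar>F m\<bar>" using x1 by (simp add: x2_def)
    finally have "F x2 \<le> 0" by linarith
    then show ?thesis using that[of x2] \<open>m \<le> x2\<close> by (simp add: m_def)
  qed
  obtain R where "x0 \<le> R" "R \<le> x2" "F R = 0"
    using IVT2'[of F x2 0 x0] x0 x2 contF[of x0 x2] by auto
  then have "R > r \<and> F R = 0" using x0 by simp
  moreover have "R' = R" if "R' > r \<and> F R' = 0" for R'
    using unique[of R R'] unique[of R' R] that calculation by (cases R R' rule: linorder_cases) auto
  ultimately show ?thesis unfolding F_def by blast
qed

text \<open>
  The decreasing quantity is \<open>E = ln (1 + p\<^sup>2)/2 + \<integral> p\<close>, with \<open>E' = -(n-1) p\<^sup>2/\<rho>\<close>. The decrease is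
  strict near \<open>r\<close>, where \<open>p\<close> is positive, and the integral contributes nothing at \<open>R\<close>.
\<close>

lemma profile_outer_slope:
  assumes n: "n \<ge> 2" and r: "r > 0" and \<alpha>: "\<alpha> > 0" and R: "R > r"
    and p: "profile n r \<alpha> p" and int: "integral {r..R} p = 0"
  shows "- \<alpha> < p R"
proof -
  define k where "k = real n - 1"
  have k: "k > 0" using n by (simp add: k_def)
  have p0: "p r = \<alpha>" using p by (simp add: profile_def)
  have pD': "(p has_real_derivative - (1 + (p t)\<^sup>2) * (1 + k / t * p t)) (at t)"
    if "t > r" for t using profile_interior_deriv[OF p that] by (simp add: k_def)
  have cont: "continuous_on {r..b} p" for b
    by (rule continuous_on_subset[OF profile_continuous_on[OF p]]) auto
  define F where "F = (\<lambda>t. integral {r..t} p)"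
  have FD: "(F has_real_derivative p t) (at t within {r..b})" if "t \<in> {r..b}" for t b
    unfolding F_def by (rule profile_primitive_deriv(1)[OF p that])
  have FD': "(F has_real_derivative p t) (at t)" if "t > r" for t
    unfolding F_def by (rule profile_primitive_deriv(2)[OF p that])
  have contF: "continuous_on {r..b} F" for b by (rule DERIV_continuous_on[OF FD])
  define E where "E = (\<lambda>t. ln (1 + (p t)\<^sup>2) / 2 + F t)"
  have pos: "1 + y\<^sup>2 > 0" for y :: real by (simp add: add_pos_nonneg)
  have ED: "(E has_real_derivative - (k * (p t)\<^sup>2 / t)) (at t)" if "t > r" for t
  proof -
    define d where "d = - (1 + (p t)\<^sup>2) * (1 + k / t * p t)"
    have D: "(p has_real_derivative d) (at t)" using pD'[OF that] by (simp add: d_def)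
    have inv: "inverse (1 + (p t)\<^sup>2) * (1 + (p t)\<^sup>2) = 1"
      using pos[of "p t"] by (intro left_inverse) simp
    have "((\<lambda>t. 1 + (p t)\<^sup>2) has_real_derivative 2 * p t * d) (at t)"
      by (rule derivative_eq_intros D refl | simp)+
    from DERIV_chain2[OF DERIV_ln[OF pos] this]
    have "((\<lambda>t. ln (1 + (p t)\<^sup>2)) has_real_derivative inverse (1 + (p t)\<^sup>2) * (2 * p t * d)) (at t)" .
    from DERIV_add[OF DERIV_cdivide[OF this, of 2] FD'[OF that]]
    have "(E has_real_derivative inverse (1 + (p t)\<^sup>2) * (2 * p t * d) / 2 + p t) (at t)"
      unfolding E_def .
    also have "inverse (1 + (p t)\<^sup>2) * (2 * p t * d) / 2
        = inverse (1 + (p t)\<^sup>2) * (1 + (p t)\<^sup>2) * (- p t * (1 + k / t * p t))"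
      unfolding d_def minus_mult_left[symmetric] minus_mult_right[symmetric] mult.assoc
      by (simp only: mult_ac) simp
    also have "\<dots> + p t = - (k * (p t)\<^sup>2 / t)"
      unfolding inv by (simp add: algebra_simps power2_eq_square)
    finally show ?thesis .
  qed
  have contE: "continuous_on {r..R} E"
    unfolding E_def using pos by (intro continuous_intros cont contF) (auto simp: less_le)
  have anti: "E t \<le> E s" if "r \<le> s" "s \<le> t" "t \<le> R" for s t
  proof (rule DERIV_nonpos_imp_decreasing_open[of s t E])
    fix x assume x: "s < x" "x < t"
    then have "- (k * (p x)\<^sup>2 / x) \<le> 0" using that k r by simp
    moreover have "(E has_real_derivative - (k * (p x)\<^sup>2 / x)) (at x)"
      using x that by (intro ED) simp
    ultimately show "\<exists>y. (E has_real_derivative y) (at x) \<and> y \<le> 0" by blast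
  qed (use that in \<open>auto intro: continuous_on_subset[OF contE]\<close>)
  have "(p \<longlongrightarrow> p r) (at r within {r..R})"
    using cont[of R] R by (simp add: continuous_on_def)
  then have "eventually (\<lambda>t. p t > 0) (at r within {r..R})"
    by (rule order_tendstoD(1)) (simp add: p0 \<alpha>)
  then obtain d where d: "d > 0" "\<And>t. t \<in> {r..R} \<Longrightarrow> t \<noteq> r \<Longrightarrow> dist t r < d \<Longrightarrow> p t > 0"
    unfolding eventually_at by auto
  define s where "s = r + min d (R - r) / 2"
  have s: "r < s" "s \<le> R" using d(1) R by (auto simp: s_def min_def field_simps)
  have "E s < E r"
  proof (rule DERIV_neg_imp_decreasing_open[of r s E])
    fix x assume x: "r < x" "x < s"
    then have "p x > 0" using d(2)[of x] s by (auto simp: s_def dist_real_def)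
    then have "- (k * (p x)\<^sup>2 / x) < 0" using k x r by simp
    moreover have "(E has_real_derivative - (k * (p x)\<^sup>2 / x)) (at x)"
      using x by (intro ED) simp
    ultimately show "\<exists>y. (E has_real_derivative y) (at x) \<and> y < 0" by blast
  qed (use s in \<open>auto intro: continuous_on_subset[OF contE]\<close>)
  moreover have "E R \<le> E s" using anti[of s R] s by simp
  ultimately have "ln (1 + (p R)\<^sup>2) < ln (1 + \<alpha>\<^sup>2)"
    using int by (simp add: E_def F_def p0)
  then have "(p R)\<^sup>2 < \<alpha>\<^sup>2"
    using pos by simp
  then have "\<bar>p R\<bar> < \<alpha>" using \<alpha> by (intro power2_less_imp_less[of "\<bar>p R\<bar>" \<alpha>]) simp_all
  then show ?thesis by linarith
qed

section \<open>Function algebras closed under partial differentiation\<close>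

text \<open>
  Polynomials with real coefficients in the functions of \<open>G\<close>. The inductive
  definition, in place of explicit polynomials, makes every statement about iterated derivatives a
  rule induction.
\<close>

inductive_set gen_algebra :: "('a \<Rightarrow> real) set \<Rightarrow> ('a \<Rightarrow> real) set" for G where
  const: "(\<lambda>_. c) \<in> gen_algebra G"
| gen: "g \<in> G \<Longrightarrow> g \<in> gen_algebra G"
| add: "f \<in> gen_algebra G \<Longrightarrow> g \<in> gen_algebra G \<Longrightarrow> (\<lambda>x. f x + g x) \<in> gen_algebra G"
| mult: "f \<in> gen_algebra G \<Longrightarrow> g \<in> gen_algebra G \<Longrightarrow> (\<lambda>x. f x * g x) \<in> gen_algebra G"

lemma gen_algebra_minus: "f \<in> gen_algebra G \<Longrightarrow> (\<lambda>x. - f x) \<in> gen_algebra G"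
  using gen_algebra.mult[OF gen_algebra.const[of "-1"], of f] by simp

lemma GDERIV_imp_partial_deriv: "GDERIV f x :> D \<Longrightarrow> partial_deriv b f x = b \<bullet> D"
  by (metis gderiv_def frechet_derivative_at partial_deriv_def)

lemma GDERIV_imp_grad:
  fixes f :: "'a::euclidean_space \<Rightarrow> real"
  shows "GDERIV f x :> D \<Longrightarrow> grad f x = D"
  unfolding grad_def by (simp add: GDERIV_imp_partial_deriv inner_commute[of _ D] euclidean_representation)

lemma lipschitz_on_mult_bounded:
  fixes f g :: "'a::metric_space \<Rightarrow> real"
  assumes f: "L-lipschitz_on S f" and g: "M-lipschitz_on S g"
    and A: "\<And>x. x \<in> S \<Longrightarrow> \<bar>f x\<bar> \<le> A" and B: "\<And>x. x \<in> S \<Longrightarrow> \<bar>g x\<bar> \<le> B"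
    and nonneg: "A \<ge> 0" "B \<ge> 0"
  shows "(A * M + B * L)-lipschitz_on S (\<lambda>x. f x * g x)"
proof (rule lipschitz_onI)
  show "0 \<le> A * M + B * L"
    using lipschitz_on_nonneg[OF f] lipschitz_on_nonneg[OF g] nonneg by simp
  fix x y assume xy: "x \<in> S" "y \<in> S"
  have "f x * g x - f y * g y = f x * (g x - g y) + g y * (f x - f y)"
    by (simp add: algebra_simps)
  then have "dist (f x * g x) (f y * g y) \<le> \<bar>f x\<bar> * dist (g x) (g y) + \<bar>g y\<bar> * dist (f x) (f y)"
    unfolding dist_real_def by (metis abs_mult abs_triangle_ineq)
  also have "\<dots> \<le> A * (M * dist x y) + B * (L * dist x y)"
    using A B xy nonneg lipschitz_onD[OF f xy] lipschitz_onD[OF g xy]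
    by (intro add_mono mult_mono) auto
  finally show "dist (f x * g x) (f y * g y) \<le> (A * M + B * L) * dist x y"
    by (simp add: algebra_simps)
qed

lemma C1_imp_lipschitz:
  fixes \<phi> \<phi>' :: "real \<Rightarrow> real"
  assumes der: "\<And>t. t \<in> {a..b} \<Longrightarrow> (\<phi> has_real_derivative \<phi>' t) (at t within {a..b})"
    and cont: "continuous_on {a..b} \<phi>'"
  obtains L where "L-lipschitz_on {a..b} \<phi>"
proof -
  have "bounded (\<phi>' ` {a..b})"
    by (intro compact_imp_bounded compact_continuous_image cont) simp
  then obtain L where L: "L > 0" "\<And>t. t \<in> {a..b} \<Longrightarrow> \<bar>\<phi>' t\<bar> \<le> L"
    unfolding bounded_pos by auto
  have "L-lipschitz_on {a..b} \<phi>"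
  proof (rule lipschitz_onI)
    fix s t assume st: "s \<in> {a..b}" "t \<in> {a..b}"
    have "norm (\<phi> s - \<phi> t) \<le> L * norm (s - t)"
      using der L(2) st by (intro field_differentiable_bound[of "{a..b}" \<phi> \<phi>']) auto
    then show "dist (\<phi> s) (\<phi> t) \<le> L * dist s t" by (simp add: dist_norm)
  qed (use L in simp)
  then show ?thesis by (rule that)
qed

text \<open>
  Enough for all elements of the algebra to be smooth up to the boundary: on \<open>\<Omega>\<close> the components of
  the gradients of the generators are again in the algebra, so that no differentiation ever leaves
  it. The Lipschitz condition is imposed on the closure directly, since \<open>\<Omega>\<close> need not be convex
  and gradient bounds alone would not give it.
\<close>

locale smooth_generators =
  fixes \<Omega> :: "'a::euclidean_space set" and G :: "('a \<Rightarrow> real) set"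
  assumes open_domain: "open \<Omega>" and bounded_domain: "bounded \<Omega>"
    and gen_GDERIV: "\<And>g. g \<in> G \<Longrightarrow>
          \<exists>D. (\<forall>x\<in>\<Omega>. GDERIV g x :> D x) \<and> (\<forall>b. (\<lambda>x. b \<bullet> D x) \<in> gen_algebra G)"
    and gen_lipschitz: "\<And>g. g \<in> G \<Longrightarrow> \<exists>L. L-lipschitz_on (closure \<Omega>) g"
begin

lemma algebra_GDERIV:
  assumes "f \<in> gen_algebra G"
  shows "\<exists>D. (\<forall>x\<in>\<Omega>. GDERIV f x :> D x) \<and> (\<forall>b. (\<lambda>x. b \<bullet> D x) \<in> gen_algebra G)"
  using assms
proof induction
  case (const c)
  show ?case
    by (intro exI[of _ "\<lambda>_. 0"]) (auto simp: GDERIV_const gen_algebra.const)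
next
  case (gen g)
  then show ?case by (rule gen_GDERIV)
next
  case (add f g)
  then obtain D E where "\<forall>x\<in>\<Omega>. GDERIV f x :> D x" "\<forall>x\<in>\<Omega>. GDERIV g x :> E x"
    "\<And>b. (\<lambda>x. b \<bullet> D x) \<in> gen_algebra G" "\<And>b. (\<lambda>x. b \<bullet> E x) \<in> gen_algebra G" by blast
  then show ?case
    by (intro exI[of _ "\<lambda>x. D x + E x"]) (auto simp: inner_add_right intro: GDERIV_add gen_algebra.add)
next
  case (mult f g)
  then obtain D E where "\<forall>x\<in>\<Omega>. GDERIV f x :> D x" "\<forall>x\<in>\<Omega>. GDERIV g x :> E x"
    "\<And>b. (\<lambda>x. b \<bullet> D x) \<in> gen_algebra G" "\<And>b. (\<lambda>x. b \<bullet> E x) \<in> gen_algebra G" by blast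
  then show ?case using mult.hyps
    by (intro exI[of _ "\<lambda>x. f x *\<^sub>R E x + g x *\<^sub>R D x"])
       (auto simp: inner_add_right intro!: GDERIV_mult gen_algebra.add gen_algebra.mult)
qed

lemma algebra_lipschitz:
  assumes "f \<in> gen_algebra G"
  shows "\<exists>L. L-lipschitz_on (closure \<Omega>) f"
  using assms
proof induction
  case (const c)
  show ?case using lipschitz_on_constant by blast
next
  case (gen g)
  then show ?case by (rule gen_lipschitz)
next
  case (add f g)
  then show ?case using lipschitz_on_add by blast
next
  case (mult f g)
  then obtain L M where lip: "L-lipschitz_on (closure \<Omega>) f" "M-lipschitz_on (closure \<Omega>) g" by blast
  have bdd: "\<exists>A\<ge>0. \<forall>x\<in>closure \<Omega>. \<bar>h x\<bar> \<le> A" if "K-lipschitz_on (closure \<Omega>) h"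
    for h :: "'a \<Rightarrow> real" and K
  proof -
    have "bounded (h ` closure \<Omega>)"
      using lipschitz_on_continuous_on[OF that] bounded_domain
      by (intro compact_imp_bounded compact_continuous_image) auto
    then obtain A where "A > 0" "\<forall>y\<in>h ` closure \<Omega>. norm y \<le> A" unfolding bounded_pos by blast
    then show ?thesis by (intro exI[of _ A]) auto
  qed
  obtain A B where "A \<ge> 0" "\<forall>x\<in>closure \<Omega>. \<bar>f x\<bar> \<le> A" "B \<ge> 0" "\<forall>x\<in>closure \<Omega>. \<bar>g x\<bar> \<le> B"
    using bdd[OF lip(1)] bdd[OF lip(2)] by blast
  then show ?case using lipschitz_on_mult_bounded[OF lip, of A B] by blast
qed

lemma partial_deriv_in_algebra:
  assumes h: "h \<in> gen_algebra G" and eq: "\<forall>x\<in>\<Omega>. f x = h x"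
  shows "\<forall>x\<in>\<Omega>. f differentiable (at x)"
    and "\<exists>h'\<in>gen_algebra G. \<forall>x\<in>\<Omega>. partial_deriv b f x = h' x"
proof -
  obtain D where D: "\<And>x. x \<in> \<Omega> \<Longrightarrow> GDERIV h x :> D x" and alg: "(\<lambda>x. b \<bullet> D x) \<in> gen_algebra G"
    using algebra_GDERIV[OF h] by blast
  have Df: "GDERIV f x :> D x" if "x \<in> \<Omega>" for x
    using D[OF that] unfolding gderiv_def
    by (rule has_derivative_transform_within_open[OF _ open_domain that]) (simp add: eq)
  show "\<forall>x\<in>\<Omega>. f differentiable (at x)"
    using Df unfolding gderiv_def differentiable_def by blast
  show "\<exists>h'\<in>gen_algebra G. \<forall>x\<in>\<Omega>. partial_deriv b f x = h' x"
    using GDERIV_imp_partial_deriv[OF Df, of _ b] by (intro bexI[OF _ alg]) simp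
qed

lemma iter_partial_in_algebra:
  assumes f: "f \<in> gen_algebra G"
  shows "\<exists>h\<in>gen_algebra G. \<forall>x\<in>\<Omega>. iter_partial bs f x = h x"
proof (induction bs)
  case Nil
  then show ?case using f by (auto simp: iter_partial_def)
next
  case (Cons b bs)
  then obtain h where "h \<in> gen_algebra G" "\<forall>x\<in>\<Omega>. iter_partial bs f x = h x" by blast
  from partial_deriv_in_algebra(2)[OF this, of b] show ?case
    by (simp add: iter_partial_def)
qed

lemma algebra_smooth_closure:
  assumes f: "f \<in> gen_algebra G"
  shows "smooth_closure \<Omega> f"
proof -
  have cont: "continuous_on (closure \<Omega>) h" if "h \<in> gen_algebra G" for h
    using algebra_lipschitz[OF that] lipschitz_on_continuous_on by blast
  have "\<forall>x\<in>\<Omega>. iter_partial bs f differentiable (at x)" for bs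
    using iter_partial_in_algebra[OF f, of bs] partial_deriv_in_algebra(1) by blast
  moreover have "\<exists>g. continuous_on (closure \<Omega>) g \<and> (\<forall>x\<in>\<Omega>. g x = iter_partial bs f x)" for bs
    using iter_partial_in_algebra[OF f, of bs] cont by metis
  ultimately show ?thesis
    unfolding smooth_closure_def Ck_closure_def using cont[OF f] by blast
qed

text \<open>
  On a bounded set of diameter \<open>d\<close>, \<open>|x - y| \<le> d\<^sup>1\<^sup>-\<^sup>\<gamma> |x - y|\<^sup>\<gamma>\<close>, so Lipschitz functions are Hoelder with
  every exponent up to one.
\<close>

lemma algebra_Holder_closure:
  assumes f: "f \<in> gen_algebra G" and \<gamma>: "0 < \<gamma>" "\<gamma> \<le> 1"
  shows "Holder_closure k \<gamma> \<Omega> f"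
proof -
  have "\<exists>L. \<forall>x\<in>\<Omega>. \<forall>y\<in>\<Omega>. \<bar>iter_partial bs f x - iter_partial bs f y\<bar> \<le> L * dist x y powr \<gamma>" for bs
  proof -
    obtain h where h: "h \<in> gen_algebra G" "\<forall>x\<in>\<Omega>. iter_partial bs f x = h x"
      using iter_partial_in_algebra[OF f] by blast
    obtain L where L: "L-lipschitz_on (closure \<Omega>) h" using algebra_lipschitz[OF h(1)] by blast
    obtain d where d: "d > 0" "\<And>x y. x \<in> \<Omega> \<Longrightarrow> y \<in> \<Omega> \<Longrightarrow> dist x y \<le> d"
      using bounded_domain unfolding bounded_two_points
      by (metis less_le_not_le linorder_not_le max.bounded_iff max_def zero_less_one)
    have "\<bar>h x - h y\<bar> \<le> (L * d powr (1 - \<gamma>)) * dist x y powr \<gamma>" if xy: "x \<in> \<Omega>" "y \<in> \<Omega>" for x y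
    proof (cases "x = y")
      case False
      have "\<bar>h x - h y\<bar> \<le> L * dist x y"
        using lipschitz_onD[OF L] xy closure_subset by (fastforce simp: dist_real_def)
      also have "dist x y = dist x y powr (1 - \<gamma>) * dist x y powr \<gamma>"
        using False by (simp flip: powr_add)
      also have "L * \<dots> \<le> L * (d powr (1 - \<gamma>) * dist x y powr \<gamma>)"
        using lipschitz_on_nonneg[OF L] d(2)[OF xy] \<gamma>
        by (intro mult_left_mono mult_right_mono powr_mono2) auto
      finally show ?thesis by (simp add: mult_ac)
    qed simp
    then show ?thesis using h(2) by auto
  qed
  then show ?thesis
    using algebra_smooth_closure[OF f] unfolding Holder_closure_def smooth_closure_def by blast
qed

end

lemma GDERIV_inner_const: "GDERIV (\<lambda>x. x \<bullet> c) x :> c"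
  unfolding gderiv_def by (rule derivative_eq_intros refl | simp)+

lemma linear_generator_GDERIV:
  "\<exists>D. (\<forall>x\<in>\<Omega>. GDERIV (\<lambda>x. x \<bullet> c) x :> D x) \<and> (\<forall>b. (\<lambda>x. b \<bullet> D x) \<in> gen_algebra G)"
  by (intro exI[of _ "\<lambda>_. c"]) (auto simp: GDERIV_inner_const gen_algebra.const)

lemma linear_generator_lipschitz:
  fixes c :: "'a::real_inner"
  shows "\<exists>L. L-lipschitz_on S (\<lambda>x. x \<bullet> c)"
proof -
  have "(norm c)-lipschitz_on S (\<lambda>x. x \<bullet> c)"
  proof (rule lipschitz_onI)
    fix x y :: 'a
    show "dist (x \<bullet> c) (y \<bullet> c) \<le> norm c * dist x y"
      using Cauchy_Schwarz_ineq2[of "x - y" c]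
      by (simp add: dist_norm inner_diff_left mult.commute)
  qed simp
  then show ?thesis ..
qed

text \<open>
  All nonlinear generators below are of this form, with \<open>m\<close> the norm or the distance to an axis.
\<close>

lemma composed_generator_lipschitz:
  assumes "\<And>t. t \<in> {a..b} \<Longrightarrow> (\<phi> has_real_derivative \<phi>' t) (at t within {a..b})"
    and "continuous_on {a..b} \<phi>'" and m: "K-lipschitz_on S m" and "m ` S \<subseteq> {a..b}"
  shows "\<exists>L. L-lipschitz_on S (\<lambda>x. \<phi> (m x))"
proof -
  obtain L where "L-lipschitz_on {a..b} \<phi>" using C1_imp_lipschitz assms(1,2) by blast
  then have "L-lipschitz_on (m ` S) \<phi>" using assms(4) by (rule lipschitz_on_subset)
  with m show ?thesis using lipschitz_on_compose2 by blast
qed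

section \<open>The annulus and the regularity of its boundary\<close>

lemma norm_hyperplane_projection:
  fixes e w :: "'a::real_inner"
  assumes "norm e = 1"
  shows "(norm (w - (w \<bullet> e) *\<^sub>R e))\<^sup>2 = (norm w)\<^sup>2 - (w \<bullet> e)\<^sup>2"
proof -
  have "e \<bullet> e = 1" using assms by (simp add: dot_square_norm)
  then show ?thesis
    unfolding power2_norm_eq_inner
    by (simp add: inner_diff_left inner_diff_right inner_commute power2_eq_square)
qed

text \<open>
  Up to the factor \<open>c\<close>, this is the height function of the sphere of radius \<open>\<rho>\<close> over the
  hyperplane orthogonal to \<open>e\<close>, near a point \<open>x\<close> of the axis of \<open>e\<close>. The function \<open>s\<close> below satisfies
  \<open>Ds = -v/s\<close>, where \<open>v\<close> is the projection to the hyperplane, so the linear functions together with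
  \<open>s\<close> and \<open>1/s\<close> generate an algebra closed under partial derivatives. Since \<open>\<delta> < \<rho>\<close>, the height stays
  away from zero on the ball.
\<close>

lemma spherical_cap_Holder:
  fixes e x :: "'a::euclidean_space"
  assumes e: "norm e = 1" and x: "x = (x \<bullet> e) *\<^sub>R e" and \<delta>: "0 < \<delta>" "\<delta> < \<rho>"
    and \<gamma>: "0 < \<gamma>" "\<gamma> \<le> 1"
  shows "Holder_closure k \<gamma> (ball x \<delta>) (\<lambda>y. c * sqrt (\<rho>\<^sup>2 - (norm (y - (y \<bullet> e) *\<^sub>R e))\<^sup>2))"
proof -
  define v where "v = (\<lambda>y. y - (y \<bullet> e) *\<^sub>R e)"
  define s where "s = (\<lambda>y. sqrt (\<rho>\<^sup>2 - (norm (v y))\<^sup>2))"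
  define G where "G = {\<lambda>y. y \<bullet> c | c. True} \<union> {s, \<lambda>y. inverse (s y)}"
  have ee: "e \<bullet> e = 1" using e by (simp add: dot_square_norm)
  have v_diff: "v y - v z = v (y - z)" for y z
    by (simp add: v_def inner_diff_left algebra_simps)
  have v_norm: "norm (v y) \<le> norm y" for y
  proof (rule power2_le_imp_le)
    show "(norm (v y))\<^sup>2 \<le> (norm y)\<^sup>2"
      unfolding v_def norm_hyperplane_projection[OF e] by simp
  qed simp
  have v_lip: "1-lipschitz_on S (\<lambda>y. norm (v y))" for S
  proof (rule lipschitz_onI)
    fix y z
    have "dist (norm (v y)) (norm (v z)) \<le> norm (v y - v z)"
      unfolding dist_real_def by (rule norm_triangle_ineq3)
    also have "\<dots> \<le> norm (y - z)" unfolding v_diff by (rule v_norm)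
    finally show "dist (norm (v y)) (norm (v z)) \<le> 1 * dist y z" by (simp add: dist_norm)
  qed simp
  have vx: "v x = 0" using x by (simp add: v_def)
  have v_le: "norm (v y) \<le> norm (y - x)" for y
    using v_norm[of "y - x"] v_diff[of y x] vx by simp
  have pos: "0 < \<rho>\<^sup>2 - t\<^sup>2" if "t \<in> {0..\<delta>}" for t
    using that \<delta> power_strict_mono[of t \<rho> 2] by simp
  have pos_v: "0 < \<rho>\<^sup>2 - (norm (v y))\<^sup>2" if "y \<in> ball x \<delta>" for y
    using v_le[of y] that by (intro pos) (auto simp: dist_norm norm_minus_commute)
  have s_pos: "s y > 0" if "y \<in> ball x \<delta>" for y using pos_v[OF that] by (simp add: s_def)
  have image: "(\<lambda>y. norm (v y)) ` closure (ball x \<delta>) \<subseteq> {0..\<delta>}"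
  proof -
    have "norm (v y) \<le> \<delta>" if "dist x y \<le> \<delta>" for y
      using v_le[of y] that by (simp add: dist_norm norm_minus_commute)
    then show ?thesis using \<delta> by auto
  qed
  have v_inner: "b \<bullet> v y = b \<bullet> y - (y \<bullet> e) * (b \<bullet> e)" for b y
    by (simp add: v_def inner_diff_right)
  have v_GDERIV: "GDERIV (\<lambda>y. \<rho>\<^sup>2 - (norm (v y))\<^sup>2) y :> (- 2) *\<^sub>R v y" for y
    unfolding power2_norm_eq_inner gderiv_def v_def
    by (rule derivative_eq_intros refl)+
       (simp add: inner_diff_left inner_diff_right ee algebra_simps inner_commute)
  have s_GDERIV: "GDERIV s y :> (- inverse (s y)) *\<^sub>R v y" if "y \<in> ball x \<delta>" for y
  proof -
    have "GDERIV s y :> (inverse (s y) / 2) *\<^sub>R ((- 2) *\<^sub>R v y)"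
      unfolding s_def using pos_v[OF that]
      by (intro GDERIV_DERIV_compose v_GDERIV DERIV_real_sqrt) 
    then show ?thesis by simp
  qed
  interpret smooth_generators "ball x \<delta>" G
  proof
    fix g assume g: "g \<in> G"
    have lin: "(\<lambda>y. y \<bullet> c) \<in> gen_algebra G" for c by (rule gen_algebra.gen) (auto simp: G_def)
    have inv: "(\<lambda>y. inverse (s y)) \<in> gen_algebra G" by (rule gen_algebra.gen) (auto simp: G_def)
    have v_alg: "(\<lambda>y. b \<bullet> v y) \<in> gen_algebra G" for b
    proof -
      have "(\<lambda>y. y \<bullet> b + - ((y \<bullet> e) * (b \<bullet> e))) \<in> gen_algebra G"
        by (intro gen_algebra.add gen_algebra_minus gen_algebra.mult gen_algebra.const lin)
      then show ?thesis by (simp add: v_inner inner_commute)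
    qed
    consider c where "g = (\<lambda>y. y \<bullet> c)" | "g = s" | "g = (\<lambda>y. inverse (s y))"
      using g by (auto simp: G_def)
    then show "\<exists>D. (\<forall>y\<in>ball x \<delta>. GDERIV g y :> D y) \<and> (\<forall>b. (\<lambda>y. b \<bullet> D y) \<in> gen_algebra G)"
    proof cases
      case (1 c)
      then show ?thesis using linear_generator_GDERIV by blast
    next
      case 2
      have "(\<lambda>y. b \<bullet> ((- inverse (s y)) *\<^sub>R v y)) \<in> gen_algebra G" for b
        unfolding inner_scaleR_right by (intro gen_algebra.mult gen_algebra_minus inv v_alg)
      then show ?thesis
        unfolding 2 using s_GDERIV by (intro exI[of _ "\<lambda>y. (- inverse (s y)) *\<^sub>R v y"]) blast
    next
      case 3
      have "(\<lambda>y. b \<bullet> ((inverse (s y) * inverse (s y) * inverse (s y)) *\<^sub>R v y)) \<in> gen_algebra G" for b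
        unfolding inner_scaleR_right by (intro gen_algebra.mult inv v_alg)
      moreover have "GDERIV (\<lambda>y. inverse (s y)) y :>
          (inverse (s y) * inverse (s y) * inverse (s y)) *\<^sub>R v y" if "y \<in> ball x \<delta>" for y
      proof -
        have "GDERIV (\<lambda>y. inverse (s y)) y :> (- (inverse (s y))\<^sup>2) *\<^sub>R ((- inverse (s y)) *\<^sub>R v y)"
          using s_pos[OF that] by (intro GDERIV_inverse s_GDERIV that) simp
        then show ?thesis by (simp add: power2_eq_square)
      qed
      ultimately show ?thesis
        unfolding 3
        by (intro exI[of _ "\<lambda>y. (inverse (s y) * inverse (s y) * inverse (s y)) *\<^sub>R v y"]) blast
    qed
    have sqrt_D: "((\<lambda>t. sqrt (\<rho>\<^sup>2 - t\<^sup>2)) has_real_derivative - t / sqrt (\<rho>\<^sup>2 - t\<^sup>2)) (at t within {0..\<delta>})"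
      if "t \<in> {0..\<delta>}" for t
    proof -
      have "((\<lambda>t. \<rho>\<^sup>2 - t\<^sup>2) has_real_derivative - 2 * t) (at t within {0..\<delta>})"
        by (rule derivative_eq_intros refl | simp)+
      from DERIV_chain2[OF DERIV_real_sqrt[OF pos[OF that]] this]
      have "((\<lambda>t. sqrt (\<rho>\<^sup>2 - t\<^sup>2)) has_real_derivative
          inverse (sqrt (\<rho>\<^sup>2 - t\<^sup>2)) / 2 * (- 2 * t)) (at t within {0..\<delta>})" .
      moreover have "c / 2 * (- 2 * t) = - t * c" for c by simp
      ultimately show ?thesis unfolding divide_inverse[of "- t"] by metis
    qed
    have cont: "continuous_on {0..\<delta>} (\<lambda>t. sqrt (\<rho>\<^sup>2 - t\<^sup>2))"
      by (intro continuous_intros)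
    have nz: "sqrt (\<rho>\<^sup>2 - t\<^sup>2) \<noteq> 0" if "t \<in> {0..\<delta>}" for t using pos[OF that] by simp
    have cont_D: "continuous_on {0..\<delta>} (\<lambda>t. - t / sqrt (\<rho>\<^sup>2 - t\<^sup>2))"
      by (intro continuous_intros ballI nz)
    from \<open>g \<in> G\<close> consider c where "g = (\<lambda>y. y \<bullet> c)" | "g = s" | "g = (\<lambda>y. inverse (s y))"
      by (auto simp: G_def)
    then show "\<exists>L. L-lipschitz_on (closure (ball x \<delta>)) g"
    proof cases
      case (1 c)
      then show ?thesis using linear_generator_lipschitz by blast
    next
      case 2
      show ?thesis unfolding 2 s_def
        by (rule composed_generator_lipschitz[OF sqrt_D cont_D v_lip image])
    next
      case 3
      show ?thesis unfolding 3 s_def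
        by (rule composed_generator_lipschitz[OF DERIV_inverse_fun[OF sqrt_D nz] _ v_lip image])
           (use nz in \<open>auto intro!: continuous_intros cont\<close>)
    qed
  qed simp_all
  have "(\<lambda>y. c * s y) \<in> gen_algebra G"
    by (intro gen_algebra.mult gen_algebra.const gen_algebra.gen) (simp add: G_def)
  from algebra_Holder_closure[OF this \<gamma>] show ?thesis
    by (simp add: s_def v_def)
qed

lemma annulus_eq:
  assumes "r > 0"
  shows "annulus r R = {x. r < norm x \<and> norm x < R}"
  using assms by (auto simp: annulus_def)

lemma open_annulus: "open (annulus r R)"
  unfolding annulus_def by (intro open_Diff) auto

lemma bounded_annulus: "bounded (annulus r R)"
  unfolding annulus_def by (rule bounded_subset[OF bounded_ball]) auto

text \<open>
  A point of the closed annulus is approached by points of the open one along its ray from the origin.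
\<close>

lemma closure_annulus:
  assumes r: "0 < r" "r < R"
  shows "closure (annulus r R :: 'a::euclidean_space set) = {x. r \<le> norm x \<and> norm x \<le> R}"
proof
  show "closure (annulus r R) \<subseteq> {x::'a. r \<le> norm x \<and> norm x \<le> R}"
    unfolding annulus_eq[OF r(1)]
    by (intro closure_minimal closed_Collect_conj closed_Collect_le continuous_intros) auto
  show "{x::'a. r \<le> norm x \<and> norm x \<le> R} \<subseteq> closure (annulus r R)"
  proof
    fix x :: 'a assume "x \<in> {x. r \<le> norm x \<and> norm x \<le> R}"
    then have x: "norm x \<in> closure {r<..<R}" "norm x > 0" using r by auto
    have "(\<lambda>t. t *\<^sub>R sgn x) ` closure {r<..<R} \<subseteq> closure (annulus r R)"
    proof (rule image_closure_subset)
      show "(\<lambda>t. t *\<^sub>R sgn x) ` {r<..<R} \<subseteq> closure (annulus r R)"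
        using x r closure_subset[of "annulus r R"] by (auto simp: annulus_eq[OF r(1)] norm_sgn)
    qed (auto intro!: continuous_intros)
    moreover have "x = norm x *\<^sub>R sgn x" using x by (simp add: sgn_div_norm)
    ultimately show "x \<in> closure (annulus r R)" using x(1) by force
  qed
qed

lemma frontier_annulus:
  assumes r: "0 < r" "r < R"
  shows "frontier (annulus r R :: 'a::euclidean_space set) = sphere 0 r \<union> sphere 0 R"
  unfolding frontier_def closure_annulus[OF r] interior_open[OF open_annulus]
  unfolding annulus_eq[OF r(1)] using r by auto

text \<open>
  A ball is convex, but the annulus contains two opposite points and not their midpoint \<open>0\<close>.
\<close>

lemma annulus_not_ball:
  assumes r: "0 < r" "r < R"
  shows "annulus r R \<noteq> (ball x0 s :: 'a::euclidean_space set)"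
proof
  assume eq: "annulus r R = (ball x0 s :: 'a set)"
  obtain b :: 'a where "b \<in> Basis" using nonempty_Basis by blast
  define y where "y = ((r + R) / 2) *\<^sub>R b"
  have "norm y = (r + R) / 2" using r \<open>b \<in> Basis\<close> by (simp add: y_def)
  then have "y \<in> annulus r R" "- y \<in> annulus r R" using r by (auto simp: annulus_eq)
  then have "midpoint y (- y) \<in> annulus r R"
    unfolding eq midpoint_def scaleR_add_right
    by (intro convexD[OF convex_ball]) auto
  then show False using r by (simp add: annulus_eq midpoint_def)
qed

text \<open>
  The axis direction \<open>e\<close> has to point out of the annulus: towards the origin on the inner sphere and
  away from it on the outer one. The radius \<open>\<delta>\<close> keeps the ball away from the other sphere and on one
  side of the equator, where being below the graph is a comparison of squared norms.
\<close>

lemma annulus_Holder_boundary: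
  assumes r: "0 < r" "r < R" and \<gamma>: "0 < \<gamma>" "\<gamma> \<le> 1"
  shows "Holder_boundary k \<gamma> (annulus r R :: 'a::euclidean_space set)"
  unfolding Holder_boundary_def
proof
  fix x :: 'a assume "x \<in> frontier (annulus r R)"
  then consider "norm x = r" | "norm x = R" unfolding frontier_annulus[OF r] by auto
  then show "\<exists>e g \<delta>. norm e = 1 \<and> 0 < \<delta> \<and>
      Holder_closure k \<gamma> (ball x \<delta>) (\<lambda>y. g (y - (y \<bullet> e) *\<^sub>R e)) \<and>
      annulus r R \<inter> ball x \<delta> = {y \<in> ball x \<delta>. y \<bullet> e < g (y - (y \<bullet> e) *\<^sub>R e)}"
  proof cases
    case 1
    define e where "e = - sgn x"
    define \<delta> where "\<delta> = min (r / 2) (R - r)"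
    define g where "g = (\<lambda>z::'a. (- 1) * sqrt (r\<^sup>2 - (norm z)\<^sup>2))"
    have e: "norm e = 1" using 1 r by (auto simp: e_def norm_sgn)
    have xe: "x \<bullet> e = - r" using 1 r by (simp add: e_def sgn_div_norm dot_square_norm power2_eq_square)
    have x: "x = (x \<bullet> e) *\<^sub>R e" unfolding xe using 1 r by (simp add: e_def sgn_div_norm)
    have \<delta>: "0 < \<delta>" "\<delta> < r" using r by (auto simp: \<delta>_def)
    have "y \<in> annulus r R \<longleftrightarrow> y \<bullet> e < g (y - (y \<bullet> e) *\<^sub>R e)" if y: "y \<in> ball x \<delta>" for y
    proof -
      have d: "norm (y - x) < \<delta>" using y by (simp add: dist_norm norm_minus_commute)
      have "norm y < R" using d 1 norm_triangle_sub[of y x] by (simp add: \<delta>_def)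
      have "\<bar>(y - x) \<bullet> e\<bar> \<le> norm (y - x)" using Cauchy_Schwarz_ineq2[of "y - x" e] e by simp
      then have neg: "y \<bullet> e < 0" using d \<delta> xe by (simp add: inner_diff_left)
      have "y \<bullet> e < g (y - (y \<bullet> e) *\<^sub>R e) \<longleftrightarrow> sqrt (r\<^sup>2 - ((norm y)\<^sup>2 - (y \<bullet> e)\<^sup>2)) < sqrt ((y \<bullet> e)\<^sup>2)"
        using neg by (auto simp: g_def norm_hyperplane_projection[OF e])
      also have "\<dots> \<longleftrightarrow> r\<^sup>2 < (norm y)\<^sup>2" unfolding real_sqrt_less_iff by auto
      also have "\<dots> \<longleftrightarrow> r < norm y" using r by (simp flip: not_le)
      finally show ?thesis using \<open>norm y < R\<close> by (simp add: annulus_eq[OF r(1)])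
    qed
    moreover have "Holder_closure k \<gamma> (ball x \<delta>) (\<lambda>y. g (y - (y \<bullet> e) *\<^sub>R e))"
      unfolding g_def by (rule spherical_cap_Holder[OF e x \<delta> \<gamma>])
    ultimately show ?thesis using e \<delta>
      by (intro exI[of _ e] exI[of _ g] exI[of _ \<delta>]) auto
  next
    case 2
    define e where "e = sgn x"
    define \<delta> where "\<delta> = min (R / 2) (R - r)"
    define g where "g = (\<lambda>z::'a. 1 * sqrt (R\<^sup>2 - (norm z)\<^sup>2))"
    have e: "norm e = 1" using 2 r by (auto simp: e_def norm_sgn)
    have xe: "x \<bullet> e = R" using 2 r by (simp add: e_def sgn_div_norm dot_square_norm power2_eq_square)
    have x: "x = (x \<bullet> e) *\<^sub>R e" unfolding xe using 2 r by (simp add: e_def sgn_div_norm)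
    have \<delta>: "0 < \<delta>" "\<delta> < R" using r by (auto simp: \<delta>_def)
    have "y \<in> annulus r R \<longleftrightarrow> y \<bullet> e < g (y - (y \<bullet> e) *\<^sub>R e)" if y: "y \<in> ball x \<delta>" for y
    proof -
      have d: "norm (y - x) < \<delta>" using y by (simp add: dist_norm norm_minus_commute)
      have "r < norm y" using d 2 norm_triangle_sub[of x y] by (simp add: \<delta>_def norm_minus_commute)
      have "\<bar>(y - x) \<bullet> e\<bar> \<le> norm (y - x)" using Cauchy_Schwarz_ineq2[of "y - x" e] e by simp
      then have pos: "y \<bullet> e > 0" using d \<delta> xe by (simp add: inner_diff_left)
      have "y \<bullet> e < g (y - (y \<bullet> e) *\<^sub>R e) \<longleftrightarrow> sqrt ((y \<bullet> e)\<^sup>2) < sqrt (R\<^sup>2 - ((norm y)\<^sup>2 - (y \<bullet> e)\<^sup>2))"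
        using pos by (auto simp: g_def norm_hyperplane_projection[OF e])
      also have "\<dots> \<longleftrightarrow> (norm y)\<^sup>2 < R\<^sup>2" unfolding real_sqrt_less_iff by auto
      also have "\<dots> \<longleftrightarrow> norm y < R" using r by (simp flip: not_le)
      finally show ?thesis using \<open>r < norm y\<close> by (simp add: annulus_eq[OF r(1)])
    qed
    moreover have "Holder_closure k \<gamma> (ball x \<delta>) (\<lambda>y. g (y - (y \<bullet> e) *\<^sub>R e))"
      unfolding g_def by (rule spherical_cap_Holder[OF e x \<delta> \<gamma>])
    ultimately show ?thesis using e \<delta>
      by (intro exI[of _ e] exI[of _ g] exI[of _ \<delta>]) auto
  qed
qed

section \<open>Outer normal and mean curvature of the annulus\<close>

text \<open>
  The normal is determined by the domain: if two defining functions had different unit normals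
  \<open>a \<noteq> \<nu>\<close>, the direction \<open>v = \<nu> - a\<close> would satisfy \<open>a \<bullet> v < 0 < \<nu> \<bullet> v\<close>, so that the ray from \<open>x\<close> along \<open>v\<close>
  would start inside the domain by one criterion and outside by the other.
\<close>

lemma outer_normal_eqI:
  assumes op: "open \<Omega>" and fr: "x \<in> frontier \<Omega>" and V: "open V" "x \<in> V"
    and cont: "continuous_on V G" and der: "\<And>y. y \<in> V \<Longrightarrow> (GDERIV \<phi> y :> G y) \<and> G y \<noteq> 0"
    and side: "\<Omega> \<inter> V = {y \<in> V. \<phi> y < 0}"
  shows "outer_normal \<Omega> x = sgn (G x)"
proof -
  let ?P = "\<lambda>\<nu>. \<exists>V \<phi> G. open V \<and> x \<in> V \<and> continuous_on V G \<and>
      (\<forall>y\<in>V. (GDERIV \<phi> y :> G y) \<and> G y \<noteq> 0) \<and>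
      \<Omega> \<inter> V = {y \<in> V. \<phi> y < 0} \<and> \<nu> = sgn (G x)"
  \<comment> \<open>A direction transversal to a defining function enters or leaves the domain according to its sign.\<close>
  have ray: "\<exists>d>0. \<forall>t\<in>{0<..<d}. x + t *\<^sub>R v \<in> V \<and> (x + t *\<^sub>R v \<in> \<Omega> \<longleftrightarrow> G x \<bullet> v < 0)"
    if V: "open V" "x \<in> V" and der: "\<forall>y\<in>V. (GDERIV \<phi> y :> G y) \<and> G y \<noteq> 0"
      and side: "\<Omega> \<inter> V = {y \<in> V. \<phi> y < 0}" and nz: "G x \<bullet> v \<noteq> 0"
    for V and \<phi> :: "'a \<Rightarrow> real" and G v
  proof -
    have "x \<notin> \<Omega>" using fr op by (simp add: frontier_def interior_open)
    then have "\<not> \<phi> x < 0" using side V by blast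
    have D: "GDERIV \<phi> x :> G x" using der V by blast
    have "\<phi> x = 0"
    proof (rule ccontr)
      assume "\<phi> x \<noteq> 0"
      then have "\<phi> x > 0" using \<open>\<not> \<phi> x < 0\<close> by simp
      have "isCont \<phi> x" using D unfolding gderiv_def by (rule has_derivative_continuous)
      then have "eventually (\<lambda>y. \<phi> y > 0) (at x)"
        using order_tendstoD(1)[of \<phi> "\<phi> x" "at x" 0] \<open>\<phi> x > 0\<close> unfolding isCont_def by blast
      then obtain U where U: "open U" "x \<in> U" "\<And>y. y \<in> U \<Longrightarrow> y \<noteq> x \<Longrightarrow> \<phi> y > 0"
        unfolding eventually_at_topological by blast
      have "x \<in> closure \<Omega>" using fr by (simp add: frontier_def)
      then obtain y where "y \<in> \<Omega>" "y \<in> U \<inter> V"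
        using U V open_Int_closure_eq_empty[of "U \<inter> V" \<Omega>] by (metis IntI disjoint_iff open_Int)
      then have "\<phi> y < 0" "\<phi> y > 0" using side U \<open>x \<notin> \<Omega>\<close> by blast+
      then show False by simp
    qed
    have line: "((\<lambda>t. x + t *\<^sub>R v) has_derivative (\<lambda>h. h *\<^sub>R v)) (at 0)"
      by (rule derivative_eq_intros refl | simp)+
    have "((\<lambda>t. \<phi> (x + t *\<^sub>R v)) has_derivative (\<lambda>h. (h *\<^sub>R v) \<bullet> G x)) (at 0)"
      using has_derivative_compose[OF line, of \<phi> "\<lambda>h. h \<bullet> G x"] D by (simp add: gderiv_def)
    then have DL: "((\<lambda>t. \<phi> (x + t *\<^sub>R v)) has_real_derivative G x \<bullet> v) (at 0)"
      by (simp add: has_field_derivative_def inner_commute mult.commute[of _ "v \<bullet> G x"])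
    have "continuous (at 0) (\<lambda>t. x + t *\<^sub>R v)" using line by (rule has_derivative_continuous)
    then have "eventually (\<lambda>t. x + t *\<^sub>R v \<in> V) (at 0)"
      using V unfolding isCont_def tendsto_def by simp
    then obtain d1 where d1: "d1 > 0" "\<And>t. 0 < t \<Longrightarrow> t < d1 \<Longrightarrow> x + t *\<^sub>R v \<in> V"
      unfolding eventually_at by (auto simp: dist_real_def)
    have mem: "y \<in> \<Omega> \<longleftrightarrow> \<phi> y < 0" if "y \<in> V" for y
      using side that by blast
    show ?thesis
    proof (cases "G x \<bullet> v < 0")
      case True
      from DERIV_neg_dec_right[OF DL True] obtain d2 where
        d2: "d2 > 0" "\<And>t. 0 < t \<Longrightarrow> t < d2 \<Longrightarrow> \<phi> (x + t *\<^sub>R v) < 0"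
        using \<open>\<phi> x = 0\<close> by auto
      have "x + t *\<^sub>R v \<in> V \<and> x + t *\<^sub>R v \<in> \<Omega>" if "t \<in> {0<..<min d1 d2}" for t
        using d1(2)[of t] d2(2)[of t] that mem[of "x + t *\<^sub>R v"] by simp
      then show ?thesis using True d1(1) d2(1)
        by (intro exI[of _ "min d1 d2"]) auto
    next
      case False
      with nz have "G x \<bullet> v > 0" by simp
      from DERIV_pos_inc_right[OF DL this] obtain d2 where
        d2: "d2 > 0" "\<And>t. 0 < t \<Longrightarrow> t < d2 \<Longrightarrow> \<phi> (x + t *\<^sub>R v) > 0"
        using \<open>\<phi> x = 0\<close> by auto
      have "x + t *\<^sub>R v \<in> V \<and> x + t *\<^sub>R v \<notin> \<Omega>" if "t \<in> {0<..<min d1 d2}" for t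
        using d1(2)[of t] d2(2)[of t] that mem[of "x + t *\<^sub>R v"] by simp
      then show ?thesis using False d1(1) d2(1)
        by (intro exI[of _ "min d1 d2"]) auto
    qed
  qed
  have "\<nu> = sgn (G x)" if "?P \<nu>" for \<nu>
  proof (rule ccontr)
    from that obtain V' \<phi>' G' where P: "open V'" "x \<in> V'"
      "\<forall>y\<in>V'. (GDERIV \<phi>' y :> G' y) \<and> G' y \<noteq> 0" "\<Omega> \<inter> V' = {y \<in> V'. \<phi>' y < 0}"
      and \<nu>: "\<nu> = sgn (G' x)" by blast
    assume ne: "\<nu> \<noteq> sgn (G x)"
    define a where "a = sgn (G x)"
    define v where "v = \<nu> - a"
    have nz: "G x \<noteq> 0" "G' x \<noteq> 0" using der V P by auto
    then have unit: "norm a = 1" "norm \<nu> = 1" by (auto simp: a_def \<nu> norm_sgn)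
    have "a \<bullet> \<nu> < 1"
    proof -
      have "(norm (a - \<nu>))\<^sup>2 = 2 - 2 * (a \<bullet> \<nu>)"
        using unit unfolding norm_eq_1 power2_norm_eq_inner
        by (simp add: inner_diff_left inner_diff_right inner_commute)
      moreover have "norm (a - \<nu>) > 0" using ne by (simp add: a_def)
      ultimately show ?thesis by (metis diff_gt_0_iff_gt mult.right_neutral mult_less_cancel_left_pos
            zero_less_numeral zero_less_power)
    qed
    then have av: "a \<bullet> v < 0" "\<nu> \<bullet> v > 0"
      using unit by (simp_all add: v_def inner_diff_right dot_square_norm inner_commute)
    have "G x = norm (G x) *\<^sub>R a" "G' x = norm (G' x) *\<^sub>R \<nu>"
      using nz by (simp_all add: a_def \<nu> sgn_div_norm)
    then have "G x \<bullet> v = norm (G x) * (a \<bullet> v)" "G' x \<bullet> v = norm (G' x) * (\<nu> \<bullet> v)"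
      by (metis inner_scaleR_left)+
    then have signs: "G x \<bullet> v < 0" "G' x \<bullet> v > 0"
      using av nz by (simp_all add: mult_pos_neg)
    obtain d where "d > 0" "\<And>t. t \<in> {0<..<d} \<Longrightarrow> x + t *\<^sub>R v \<in> \<Omega>"
      using ray[OF V _ side, where v = v and G = G] der signs(1) by auto
    moreover obtain d' where "d' > 0" "\<And>t. t \<in> {0<..<d'} \<Longrightarrow> x + t *\<^sub>R v \<notin> \<Omega>"
      using ray[OF P, where v = v] signs by auto
    ultimately show False
      by (metis dense greaterThanLessThan_iff min_less_iff_conj)
  qed
  moreover have "?P (sgn (G x))" using V cont der side by blast
  ultimately show ?thesis unfolding outer_normal_def by (rule the_equality[rotated])
qed

lemma annulus_outer_normal:
  fixes x :: "'a::euclidean_space"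
  assumes r: "0 < r" "r < R"
  shows "norm x = r \<Longrightarrow> outer_normal (annulus r R) x = - sgn x"
    and "norm x = R \<Longrightarrow> outer_normal (annulus r R) x = sgn x"
proof -
  have norm_D: "GDERIV norm y :> sgn y" if "y \<noteq> 0" for y :: 'a
    using that by (rule GDERIV_norm)
  have norm_cont: "continuous_on {y. norm y > c} sgn" if "c \<ge> 0" for c :: real
    using that by (intro continuous_on_sgn continuous_intros) auto
  have sgn_sgn: "sgn (sgn z) = sgn z" for z :: 'a
    by (cases "z = 0") (simp_all add: sgn_div_norm[of "sgn z"] norm_sgn)
  {
    assume x: "norm x = r"
    have "outer_normal (annulus r R) x = sgn (- sgn x)"
    proof (rule outer_normal_eqI[where V = "{y. norm y > 0} \<inter> {y. norm y < R}" and \<phi> = "\<lambda>y. r - norm y"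
            and G = "\<lambda>y. - sgn y"])
      show "x \<in> frontier (annulus r R)" unfolding frontier_annulus[OF r] using x by simp
      show "open ({y. norm y > 0} \<inter> {y::'a. norm y < R})"
        by (intro open_Int open_Collect_less continuous_intros)
      show "continuous_on ({y. norm y > 0} \<inter> {y::'a. norm y < R}) (\<lambda>y. - sgn y)"
        by (intro continuous_on_minus continuous_on_subset[OF norm_cont[of 0]]) auto
      show "GDERIV (\<lambda>y. r - norm y) y :> - sgn y \<and> - sgn y \<noteq> 0"
        if "y \<in> {y. norm y > 0} \<inter> {y. norm y < R}" for y :: 'a
        using GDERIV_diff[OF GDERIV_const norm_D, of y r] that by (simp add: sgn_zero_iff)
      show "annulus r R \<inter> ({y. norm y > 0} \<inter> {y. norm y < R})
          = {y \<in> {y. norm y > 0} \<inter> {y::'a. norm y < R}. r - norm y < 0}"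
        unfolding annulus_eq[OF r(1)] using r by auto
    qed (use x r in \<open>auto intro: open_annulus\<close>)
    then show "outer_normal (annulus r R) x = - sgn x" by (simp add: sgn_minus sgn_sgn)
  }
  {
    assume x: "norm x = R"
    have "outer_normal (annulus r R) x = sgn (sgn x)"
    proof (rule outer_normal_eqI[where V = "{y. norm y > r}" and \<phi> = "\<lambda>y. norm y - R"
            and G = "\<lambda>y. sgn y"])
      show "x \<in> frontier (annulus r R)" unfolding frontier_annulus[OF r] using x by simp
      show "open {y::'a. norm y > r}"
        by (intro open_Collect_less continuous_intros)
      show "continuous_on {y::'a. norm y > r} sgn" using r by (intro norm_cont) simp
      show "GDERIV (\<lambda>y. norm y - R) y :> sgn y \<and> sgn y \<noteq> 0"
        if "y \<in> {y. norm y > r}" for y :: 'a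
        using GDERIV_diff[OF norm_D GDERIV_const, of y R] that r by (cases "y = 0") (simp_all add: sgn_zero_iff)
      show "annulus r R \<inter> {y. norm y > r} = {y \<in> {y::'a. norm y > r}. norm y - R < 0}"
        unfolding annulus_eq[OF r(1)] by auto
    qed (use x r in \<open>auto intro: open_annulus\<close>)
    then show "outer_normal (annulus r R) x = sgn x" by (simp add: sgn_sgn)
  }
qed

text \<open>
  A derivative \<open>D\<close> of \<open>F\<close> relative to the sphere is only known on tangent vectors. The error
  \<open>E = D - \<kappa> id\<close> is a relative derivative of the zero field, so it vanishes on the tangent space, as great
  circles through \<open>x\<close> show, and hence has rank at most one: its trace is \<open>E \<nu> \<bullet> \<nu>\<close>, exactly what the
  definition of the tangential divergence subtracts.
\<close>

lemma tangential_div_homothety_sphere: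
  fixes x :: "'a::euclidean_space"
  assumes x: "norm x = \<rho>" "\<rho> > 0" and \<sigma>: "\<sigma> = 1 \<or> \<sigma> = - 1"
    and local: "at x within S = at x within sphere 0 \<rho>"
    and \<nu>: "\<nu> x = \<sigma> *\<^sub>R sgn x" and F: "\<And>y. norm y = \<rho> \<Longrightarrow> F y = \<kappa> *\<^sub>R y"
  shows "tangential_div S \<nu> F x = (real DIM('a) - 1) * \<kappa>"
proof -
  define D where "D = frechet_derivative F (at x within S)"
  have "((\<lambda>y. \<kappa> *\<^sub>R y) has_derivative (\<lambda>h. \<kappa> *\<^sub>R h)) (at x within sphere 0 \<rho>)"
    by (rule derivative_eq_intros refl)+
  then have F_D: "(F has_derivative (\<lambda>h. \<kappa> *\<^sub>R h)) (at x within sphere 0 \<rho>)"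
    by (rule has_derivative_transform[rotated 2]) (use F x in auto)
  then have D: "(F has_derivative D) (at x within sphere 0 \<rho>)"
    unfolding D_def local using frechet_derivative_works differentiable_def by blast
  define E where "E = (\<lambda>h. D h - \<kappa> *\<^sub>R h)"
  have E: "((\<lambda>_. 0) has_derivative E) (at x within sphere 0 \<rho>)"
  proof (rule has_derivative_transform)
    show "((\<lambda>y. F y - \<kappa> *\<^sub>R y) has_derivative E) (at x within sphere 0 \<rho>)"
      unfolding E_def by (intro has_derivative_diff D) (rule derivative_eq_intros refl)+
  qed (use F x in auto)
  have "linear E" using E by (rule has_derivative_linear)
  have tangent_eq: "E v = 0" if v: "norm v = \<rho>" "x \<bullet> v = 0" for v
  proof -
    have norms: "x \<bullet> x = v \<bullet> v" using v x by (simp add: dot_square_norm)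
    \<comment> \<open>The great circle through \<open>x\<close> with velocity \<open>v\<close>.\<close>
    define \<gamma> where "\<gamma> = (\<lambda>t. cos t *\<^sub>R x + sin t *\<^sub>R v)"
    have "norm (\<gamma> t) = \<rho>" for t
    proof -
      have "(norm (\<gamma> t))\<^sup>2 = (cos t)\<^sup>2 * \<rho>\<^sup>2 + (sin t)\<^sup>2 * \<rho>\<^sup>2"
        unfolding \<gamma>_def v(1)[symmetric] power2_norm_eq_inner using v(2) norms
        by (simp add: inner_add_left inner_add_right inner_commute power2_eq_square)
      also have "\<dots> = \<rho>\<^sup>2" by (simp flip: distrib_right)
      finally show ?thesis using x by (simp add: power2_eq_iff_nonneg)
    qed
    then have range: "range \<gamma> \<subseteq> sphere 0 \<rho>" by auto
    have "(\<gamma> has_derivative (\<lambda>h. h *\<^sub>R v)) (at 0)"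
      unfolding \<gamma>_def by (rule derivative_eq_intros refl | simp)+
    moreover have "((\<lambda>_. 0) has_derivative E) (at (\<gamma> 0) within range \<gamma>)"
      using has_derivative_subset[OF E range] by (simp add: \<gamma>_def)
    ultimately have "((\<lambda>_. 0) has_derivative (\<lambda>h. E (h *\<^sub>R v))) (at (0::real))"
      using has_derivative_in_compose[of \<gamma> "\<lambda>h. h *\<^sub>R v" 0 UNIV "\<lambda>_. 0" E] by simp
    moreover have "((\<lambda>_. 0) has_derivative (\<lambda>_. 0 :: 'a)) (at (0::real))" by (rule has_derivative_const)
    ultimately have "(\<lambda>h. E (h *\<^sub>R v)) = (\<lambda>_. 0)" by (rule has_derivative_unique)
    then show ?thesis by (metis scaleR_one)
  qed
  have tangent: "E v = 0" if "x \<bullet> v = 0" for v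
  proof (cases "v = 0")
    case True
    then show ?thesis using \<open>linear E\<close> by (simp add: linear_0)
  next
    case False
    have "E ((\<rho> / norm v) *\<^sub>R v) = 0"
      using False that x by (intro tangent_eq) auto
    then show ?thesis using False x \<open>linear E\<close> by (simp add: linear_cmul)
  qed
  have unit: "\<nu> x \<bullet> \<nu> x = 1"
    using \<sigma> x by (auto simp: \<nu> dot_square_norm norm_sgn)
  have E_rank1: "E w = (w \<bullet> \<nu> x) *\<^sub>R E (\<nu> x)" for w
  proof -
    have "x = (\<sigma> * \<rho>) *\<^sub>R \<nu> x" using \<sigma> x by (auto simp: \<nu> sgn_div_norm)
    then have "x \<bullet> (w - (w \<bullet> \<nu> x) *\<^sub>R \<nu> x) = (\<sigma> * \<rho>) * (\<nu> x \<bullet> (w - (w \<bullet> \<nu> x) *\<^sub>R \<nu> x))"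
      by (metis inner_scaleR_left)
    also have "\<dots> = 0" using unit by (simp add: inner_diff_right inner_commute)
    finally have "E (w - (w \<bullet> \<nu> x) *\<^sub>R \<nu> x) = 0" by (rule tangent)
    then show ?thesis using \<open>linear E\<close> by (simp add: linear_diff linear_cmul)
  qed
  have D_eq: "D w = \<kappa> *\<^sub>R w + E w" for w by (simp add: E_def)
  have "(\<Sum>b\<in>Basis. E b \<bullet> b) = (\<Sum>b\<in>Basis. (\<nu> x \<bullet> b) * (E (\<nu> x) \<bullet> b))"
    by (intro sum.cong refl, subst E_rank1) (simp add: inner_commute)
  also have "\<dots> = \<nu> x \<bullet> E (\<nu> x)" by (rule euclidean_inner[symmetric])
  finally have "(\<Sum>b\<in>Basis. D b \<bullet> b) = \<kappa> * real DIM('a) + \<nu> x \<bullet> E (\<nu> x)"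
    by (simp add: D_eq inner_add_left sum.distrib)
  then show ?thesis
    unfolding tangential_div_def Let_def D_def[symmetric]
    using unit by (simp add: D_eq inner_add_left inner_commute[of "E (\<nu> x)"] algebra_simps)
qed

text \<open>
  Near \<open>x\<close> the frontier is a single sphere, on which the normal is \<open>-y/r\<close> or \<open>y/R\<close>.
\<close>

lemma annulus_mean_curvature:
  fixes x :: "'a::euclidean_space"
  assumes r: "0 < r" "r < R" and dim: "DIM('a) \<ge> 2"
  shows "norm x = r \<Longrightarrow> mean_curvature (annulus r R) x = 1 / r"
    and "norm x = R \<Longrightarrow> mean_curvature (annulus r R) x = - 1 / R"
proof -
  have n: "real DIM('a) - 1 \<noteq> 0" using dim by simp
  {
    assume x: "norm x = r"
    have local: "at x within frontier (annulus r R) = at x within sphere 0 r"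
      using x r unfolding frontier_annulus[OF r]
      by (intro at_within_nhd[of x "ball 0 R"]) auto
    have "tangential_div (frontier (annulus r R)) (outer_normal (annulus r R))
        (outer_normal (annulus r R)) x = (real DIM('a) - 1) * (- inverse r)"
    proof (rule tangential_div_homothety_sphere[where \<sigma> = "- 1"])
      show "outer_normal (annulus r R) x = (- 1) *\<^sub>R sgn x"
        using annulus_outer_normal(1)[OF r x] by simp
      show "outer_normal (annulus r R) y = (- inverse r) *\<^sub>R y" if "norm y = r" for y :: 'a
        using annulus_outer_normal(1)[OF r that] that by (simp add: sgn_div_norm)
    qed (use x r local in simp_all)
    then show "mean_curvature (annulus r R) x = 1 / r"
      unfolding mean_curvature_def using n by (simp add: divide_inverse)
  }
  {
    assume x: "norm x = R"
    have local: "at x within frontier (annulus r R) = at x within sphere 0 R"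
      using x r unfolding frontier_annulus[OF r]
      by (intro at_within_nhd[of x "- cball 0 r"]) auto
    have "tangential_div (frontier (annulus r R)) (outer_normal (annulus r R))
        (outer_normal (annulus r R)) x = (real DIM('a) - 1) * inverse R"
    proof (rule tangential_div_homothety_sphere[where \<sigma> = "1"])
      show "outer_normal (annulus r R) x = (1) *\<^sub>R sgn x"
        using annulus_outer_normal(2)[OF r x] by simp
      show "outer_normal (annulus r R) y = inverse R *\<^sub>R y" if "norm y = R" for y :: 'a
        using annulus_outer_normal(2)[OF r that] that by (simp add: sgn_div_norm)
    qed (use x r local in simp_all)
    then show "mean_curvature (annulus r R) x = - 1 / R"
      unfolding mean_curvature_def using n by (simp add: divide_inverse)
  }
qed

section \<open>The radial solution\<close>

lemma GDERIV_radial: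
  assumes "(\<phi> has_real_derivative d) (at (norm x))" and "x \<noteq> 0"
  shows "GDERIV (\<lambda>x. \<phi> (norm x)) x :> d *\<^sub>R sgn x"
  by (rule GDERIV_DERIV_compose[OF GDERIV_norm assms(1)]) (rule assms(2))

text \<open>
  Writing the field as \<open>\<tau>(|y|) y\<close> with \<open>\<tau>(s) = \<sigma>(s)/s\<close>, its derivative is \<open>\<tau>\<close> times the identity plus a rank
  one part, with traces \<open>n \<tau>\<close> and \<open>|x| \<tau>'\<close>.
\<close>

lemma divergence_radial:
  fixes x :: "'a::euclidean_space"
  assumes \<sigma>: "(\<sigma> has_real_derivative d) (at (norm x))" and x: "x \<noteq> 0"
  shows "divergence (\<lambda>y. \<sigma> (norm y) *\<^sub>R sgn y) x = d + (real DIM('a) - 1) / norm x * \<sigma> (norm x)"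
proof -
  define \<tau> where "\<tau> = (\<lambda>t. \<sigma> t * inverse t)"
  define d' where "d' = d * inverse (norm x) - \<sigma> (norm x) * (inverse (norm x))\<^sup>2"
  have "(\<tau> has_real_derivative d') (at (norm x))"
    unfolding \<tau>_def d'_def
    by (rule derivative_eq_intros \<sigma> refl | use x in \<open>simp add: power2_eq_square\<close>)+
  then have "((\<lambda>y. \<tau> (norm y)) has_derivative (\<lambda>h. h \<bullet> (d' *\<^sub>R sgn x))) (at x)"
    using GDERIV_radial[OF _ x] unfolding gderiv_def by blast
  from has_derivative_scaleR[OF this has_derivative_ident]
  have "((\<lambda>y. \<tau> (norm y) *\<^sub>R y) has_derivative
      (\<lambda>h. \<tau> (norm x) *\<^sub>R h + (h \<bullet> (d' *\<^sub>R sgn x)) *\<^sub>R x)) (at x)" .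
  moreover have "\<sigma> (norm y) *\<^sub>R sgn y = \<tau> (norm y) *\<^sub>R y" for y :: 'a
    by (simp add: \<tau>_def sgn_div_norm)
  ultimately have "((\<lambda>y. \<sigma> (norm y) *\<^sub>R sgn y) has_derivative
      (\<lambda>h. \<tau> (norm x) *\<^sub>R h + (h \<bullet> (d' *\<^sub>R sgn x)) *\<^sub>R x)) (at x)"
    by presburger
  note D = frechet_derivative_at[OF this, symmetric]
  have "(\<Sum>b\<in>Basis. (b \<bullet> sgn x) * (b \<bullet> x)) = sgn x \<bullet> x"
    by (subst euclidean_inner[of "sgn x" x]) (simp add: inner_commute)
  also have "\<dots> = norm x" using x by (simp add: sgn_div_norm dot_square_norm power2_eq_square)
  finally have tr: "(\<Sum>b\<in>Basis. (b \<bullet> sgn x) * (b \<bullet> x)) = norm x" .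
  have "divergence (\<lambda>y. \<sigma> (norm y) *\<^sub>R sgn y) x
      = real DIM('a) * \<tau> (norm x) + d' * (\<Sum>b\<in>Basis. (b \<bullet> sgn x) * (b \<bullet> x))"
    unfolding divergence_def D
    by (simp add: inner_add_left sum.distrib sum_distrib_left inner_commute[of x] mult.assoc)
  also have "\<dots> = d + (real DIM('a) - 1) / norm x * \<sigma> (norm x)"
    unfolding tr using x by (simp add: \<tau>_def d'_def field_simps power2_eq_square)
  finally show ?thesis .
qed

text \<open>
  With \<open>\<sigma> = p/w\<close> and \<open>w = (1 + p\<^sup>2)\<^sup>1\<^sup>/\<^sup>2\<close> one has \<open>\<sigma>' = p'/w\<^sup>3\<close>. The profile equation makes this
  \<open>-(1 + (n-1) p/\<rho>)/w\<close>, and the curvature term \<open>(n-1) \<sigma>/\<rho>\<close> of the divergence cancels the second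
  part.
\<close>

lemma profile_translator_eq:
  fixes \<Omega> :: "'a::euclidean_space set"
  assumes \<Omega>: "open \<Omega>" "\<And>x. x \<in> \<Omega> \<Longrightarrow> r < norm x" and r: "r > 0"
    and p: "profile DIM('a) r \<alpha> p"
    and U: "\<And>t. t > r \<Longrightarrow> (U has_real_derivative p t) (at t)"
  shows "translator_eq \<Omega> (\<lambda>x. U (norm x))"
  unfolding translator_eq_def
proof
  fix x assume "x \<in> \<Omega>"
  define k where "k = real DIM('a) - 1"
  define t where "t = norm x"
  define w where "w = sqrt (1 + (p t)\<^sup>2)"
  have t: "t > r" using \<Omega> \<open>x \<in> \<Omega>\<close> by (simp add: t_def)
  have w: "w > 0" "w * w = 1 + (p t)\<^sup>2" by (simp_all add: w_def add_pos_nonneg)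
  have grad: "grad (\<lambda>x. U (norm x)) y = p (norm y) *\<^sub>R sgn y" if "y \<in> \<Omega>" for y
    using \<Omega>(2)[OF that] r by (intro GDERIV_imp_grad GDERIV_radial U) auto
  have norm_grad: "(norm (grad (\<lambda>x. U (norm x)) y))\<^sup>2 = (p (norm y))\<^sup>2" if "y \<in> \<Omega>" for y
    using \<Omega>(2)[OF that] r by (auto simp: grad[OF that] norm_sgn power_mult_distrib)
  define \<sigma> where "\<sigma> = (\<lambda>s. p s / sqrt (1 + (p s)\<^sup>2))"
  define d where "d = - (1 + (p t)\<^sup>2) * (1 + k / t * p t)"
  have pD: "(p has_real_derivative d) (at t)"
    using profile_interior_deriv[OF p t] by (simp add: d_def k_def)
  have "((\<lambda>s. 1 + (p s)\<^sup>2) has_real_derivative 2 * p t * d) (at t)"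
    by (rule derivative_eq_intros pD refl | simp)+
  from DERIV_chain2[OF DERIV_real_sqrt this]
  have wD: "((\<lambda>s. sqrt (1 + (p s)\<^sup>2)) has_real_derivative inverse w / 2 * (2 * p t * d)) (at t)"
    by (simp add: w_def add_pos_nonneg)
  have "(\<sigma> has_real_derivative (d * w - p t * (inverse w / 2 * (2 * p t * d))) / (w * w)) (at t)"
    unfolding \<sigma>_def using DERIV_divide[OF pD wD] w by (simp add: w_def)
  also have "(d * w - p t * (inverse w / 2 * (2 * p t * d))) / (w * w) = - (1 + k / t * p t) / w"
  proof -
    have d: "d = - (w * w) * (1 + k / t * p t)" by (simp only: d_def w(2))
    have "d * w - p t * (inverse w / 2 * (2 * p t * d)) = d * inverse w * (w * w - (p t)\<^sup>2)"
      using w(1) by (simp add: field_simps power2_eq_square)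
    also have "\<dots> = d * inverse w" by (simp add: w(2))
    also have "\<dots> / (w * w) = - (1 + k / t * p t) / w"
    proof -
      have "- (w * w) * b * inverse w / (w * w) = - b / w" for b
        using w(1) by (simp add: field_simps)
      then show ?thesis unfolding d .
    qed
    finally show ?thesis .
  qed
  finally have \<sigma>D: "(\<sigma> has_real_derivative - (1 + k / t * p t) / w) (at t)" .
  have x0: "x \<noteq> 0" using t r by (auto simp: t_def)
  have D: "(\<lambda>y. \<sigma> (norm y) *\<^sub>R sgn y) differentiable (at x)"
  proof -
    have "(\<lambda>y. (\<sigma> (norm y) * inverse (norm y)) *\<^sub>R y) differentiable (at x)"
    proof (intro differentiable_scaleR differentiable_mult differentiable_ident)
      show "(\<lambda>y. \<sigma> (norm y)) differentiable (at x)"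
        using GDERIV_radial[OF \<sigma>D[unfolded t_def] x0] unfolding gderiv_def differentiable_def by blast
      show "(\<lambda>y. inverse (norm y)) differentiable (at x)"
        using x0 by (intro differentiable_inverse differentiable_norm_at) auto
    qed
    then show ?thesis by (simp add: sgn_div_norm)
  qed
  have field: "\<sigma> (norm y) *\<^sub>R sgn y
      = (1 / sqrt (1 + (norm (grad (\<lambda>x. U (norm x)) y))\<^sup>2)) *\<^sub>R grad (\<lambda>x. U (norm x)) y"
    if "y \<in> \<Omega>" for y
    unfolding norm_grad[OF that] by (simp add: grad[OF that] \<sigma>_def)
  have "divergence (\<lambda>y. (1 / sqrt (1 + (norm (grad (\<lambda>x. U (norm x)) y))\<^sup>2)) *\<^sub>R grad (\<lambda>x. U (norm x)) y) x
      = divergence (\<lambda>y. \<sigma> (norm y) *\<^sub>R sgn y) x"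
    unfolding divergence_def
    by (subst frechet_derivative_transform_within_open[OF D \<Omega>(1) \<open>x \<in> \<Omega>\<close> field]) simp_all
  also have "\<dots> = - (1 + k / t * p t) / w + k / t * \<sigma> t"
    using divergence_radial[OF \<sigma>D[unfolded t_def] x0] by (simp add: k_def t_def)
  also have "\<dots> = - 1 / w"
    using w(1) by (simp add: \<sigma>_def flip: w_def) (simp add: diff_divide_distrib)
  finally show "- divergence (\<lambda>y. (1 / sqrt (1 + (norm (grad (\<lambda>x. U (norm x)) y))\<^sup>2)) *\<^sub>R
      grad (\<lambda>x. U (norm x)) y) x = 1 / sqrt (1 + (norm (grad (\<lambda>x. U (norm x)) x))\<^sup>2)"
    by (simp add: norm_grad[OF \<open>x \<in> \<Omega>\<close>] w_def t_def)
qed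

text \<open>
  The gradient \<open>p(|y|) y/|y|\<close> extends continuously to the closed annulus; only the orientation of
  the normal distinguishes the two spheres.
\<close>

lemma annulus_normal_deriv:
  fixes x :: "'a::euclidean_space"
  assumes r: "0 < r" "r < R" and U: "\<And>t. t > r \<Longrightarrow> (U has_real_derivative p t) (at t)"
    and cont: "continuous_on {r..R} p"
  shows "norm x = r \<Longrightarrow> normal_deriv (annulus r R) (\<lambda>x. U (norm x)) x = - p r"
    and "norm x = R \<Longrightarrow> normal_deriv (annulus r R) (\<lambda>x. U (norm x)) x = p R"
proof -
  let ?\<Omega> = "annulus r R :: 'a set"
  have lim: "Lim (at x within ?\<Omega>) (grad (\<lambda>x. U (norm x))) = p (norm x) *\<^sub>R sgn x"
    if "norm x = r \<or> norm x = R"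
  proof (rule tendsto_Lim)
    have "x \<in> closure ?\<Omega>" "x \<notin> ?\<Omega>"
      using that r unfolding closure_annulus[OF r] by (auto simp: annulus_eq[OF r(1)])
    then have "x islimpt ?\<Omega>" by (simp add: closure_def)
    then show "\<not> trivial_limit (at x within ?\<Omega>)" by (simp add: trivial_limit_within)
    have "continuous_on {y. r \<le> norm y \<and> norm y \<le> R} (\<lambda>y. p (norm y) *\<^sub>R sgn y :: 'a)"
      using r by (intro continuous_intros continuous_on_compose2[OF cont] continuous_on_sgn) auto
    then have "((\<lambda>y. p (norm y) *\<^sub>R sgn y) \<longlongrightarrow> p (norm x) *\<^sub>R sgn x)
        (at x within {y. r \<le> norm y \<and> norm y \<le> R})"
      using that r unfolding continuous_on_def by auto
    then have "((\<lambda>y. p (norm y) *\<^sub>R sgn y) \<longlongrightarrow> p (norm x) *\<^sub>R sgn x) (at x within ?\<Omega>)"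
      by (rule tendsto_within_subset) (auto simp: annulus_eq[OF r(1)])
    then show "(grad (\<lambda>x. U (norm x)) \<longlongrightarrow> p (norm x) *\<^sub>R sgn x) (at x within ?\<Omega>)"
    proof (rule Lim_transform_within[where d = 1])
      fix y :: 'a assume "y \<in> ?\<Omega>"
      then have "norm y > r" by (simp add: annulus_eq[OF r(1)])
      then show "p (norm y) *\<^sub>R sgn y = grad (\<lambda>x. U (norm x)) y"
        using r by (intro GDERIV_imp_grad[symmetric] GDERIV_radial U) auto
    qed simp
  qed
  have unit: "sgn x \<bullet> sgn x = 1" if "norm x > 0" using that by (simp add: dot_square_norm norm_sgn)
  show "norm x = r \<Longrightarrow> normal_deriv ?\<Omega> (\<lambda>x. U (norm x)) x = - p r"
    unfolding normal_deriv_def using lim annulus_outer_normal(1)[OF r, of x] unit r by simp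
  show "norm x = R \<Longrightarrow> normal_deriv ?\<Omega> (\<lambda>x. U (norm x)) x = p R"
    unfolding normal_deriv_def using lim annulus_outer_normal(2)[OF r, of x] unit r by simp
qed

text \<open>
  The generators are \<open>x \<bullet> c\<close>, \<open>1/|x|\<close>, \<open>p(|x|)\<close> and \<open>U(|x|)\<close>. The gradient of \<open>\<phi>(|x|)\<close> is \<open>\<phi>'(|x|) x/|x|\<close>, and
  \<open>\<phi>'\<close> is a polynomial in the generators in each case, for \<open>p\<close> because of the profile
  equation.
\<close>

lemma profile_solution_regular:
  assumes r: "0 < r" "r < R" and p: "profile n r \<alpha> p"
  defines "u \<equiv> (\<lambda>x :: 'a::euclidean_space. integral {r..norm x} p)"
  shows "smooth_closure (annulus r R) u"
    and "0 < \<gamma> \<Longrightarrow> \<gamma> \<le> 1 \<Longrightarrow> Holder_closure k \<gamma> (annulus r R) u"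
proof -
  define U where "U = (\<lambda>t. integral {r..t} p)"
  define G where "G = {\<lambda>x :: 'a. x \<bullet> c | c. True} \<union>
    {\<lambda>x. inverse (norm x), \<lambda>x. p (norm x), \<lambda>x. U (norm x)}"
  have lin: "(\<lambda>x. x \<bullet> c) \<in> gen_algebra G" for c by (rule gen_algebra.gen) (auto simp: G_def)
  have inv: "(\<lambda>x. inverse (norm x)) \<in> gen_algebra G" by (rule gen_algebra.gen) (auto simp: G_def)
  have pn: "(\<lambda>x. p (norm x)) \<in> gen_algebra G" by (rule gen_algebra.gen) (auto simp: G_def)
  have Un: "(\<lambda>x. U (norm x)) \<in> gen_algebra G" by (rule gen_algebra.gen) (auto simp: G_def)
  have sgn_alg: "(\<lambda>x. b \<bullet> sgn x) \<in> gen_algebra G" for b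
    using gen_algebra.mult[OF inv lin[of b]] by (simp add: sgn_div_norm inner_commute)
  define p' where "p' = (\<lambda>t. - ((1 + p t * p t) * (1 + (real n - 1) * inverse t * p t)))"
  have p'_eq: "p' t = - (1 + (p t)\<^sup>2) * (1 + (real n - 1) / t * p t)" for t
    unfolding p'_def power2_eq_square divide_inverse minus_mult_left ..
  have p'_alg: "(\<lambda>x. p' (norm x)) \<in> gen_algebra G"
    unfolding p'_def by (intro gen_algebra_minus gen_algebra.add gen_algebra.mult gen_algebra.const inv pn)
  have radial: "\<exists>D. (\<forall>x\<in>annulus r R. GDERIV (\<lambda>x. \<phi> (norm x)) x :> D x) \<and>
                  (\<forall>b. (\<lambda>x. b \<bullet> D x) \<in> gen_algebra G)"
    if \<phi>: "\<And>t. t > r \<Longrightarrow> (\<phi> has_real_derivative \<phi>' t) (at t)"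
      and alg: "(\<lambda>x. \<phi>' (norm x)) \<in> gen_algebra G" for \<phi> \<phi>'
  proof -
    have "GDERIV (\<lambda>x. \<phi> (norm x)) x :> \<phi>' (norm x) *\<^sub>R sgn x" if "x \<in> annulus r R" for x :: 'a
      using that r by (intro GDERIV_radial \<phi>) (auto simp: annulus_eq[OF r(1)])
    moreover have "(\<lambda>x. b \<bullet> (\<phi>' (norm x) *\<^sub>R sgn x)) \<in> gen_algebra G" for b
      unfolding inner_scaleR_right by (intro gen_algebra.mult alg sgn_alg)
    ultimately show ?thesis by (intro exI[of _ "\<lambda>x. \<phi>' (norm x) *\<^sub>R sgn x"]) blast
  qed
  have norm_lip: "1-lipschitz_on S (norm :: 'a \<Rightarrow> real)" for S
    by (rule lipschitz_onI) (simp_all add: dist_norm norm_triangle_ineq3)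
  have image: "norm ` closure (annulus r R :: 'a set) \<subseteq> {r..R}"
    unfolding closure_annulus[OF r] by auto
  have cont: "continuous_on {r..R} p"
    by (rule continuous_on_subset[OF profile_continuous_on[OF p]]) auto
  have invD: "((\<lambda>t. inverse t) has_real_derivative - (inverse t * inverse t)) (at t within S)"
    if "t \<ge> r" for t S
    using DERIV_inverse[of t S] that r by (simp add: power2_eq_square)
  have pD: "(p has_real_derivative p' t) (at t within {r..R})" if "t \<in> {r..R}" for t
  proof (rule DERIV_subset)
    show "(p has_real_derivative p' t) (at t within {r..})"
      using p that unfolding profile_def p'_eq by simp
  qed auto
  interpret smooth_generators "annulus r R" G
  proof
    show "open (annulus r R :: 'a set)" by (rule open_annulus)
    show "bounded (annulus r R :: 'a set)" by (rule bounded_annulus)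
    fix g assume g: "g \<in> G"
    consider c where "g = (\<lambda>x. x \<bullet> c)" | "g = (\<lambda>x. inverse (norm x))"
      | "g = (\<lambda>x. p (norm x))" | "g = (\<lambda>x. U (norm x))"
      using g by (auto simp: G_def)
    then show "\<exists>D. (\<forall>x\<in>annulus r R. GDERIV g x :> D x) \<and> (\<forall>b. (\<lambda>x. b \<bullet> D x) \<in> gen_algebra G)"
    proof cases
      case 1
      then show ?thesis using linear_generator_GDERIV by blast
    next
      case 2
      show ?thesis unfolding 2 using invD
        by (intro radial[where \<phi>' = "\<lambda>t. - (inverse t * inverse t)"] gen_algebra_minus gen_algebra.mult inv) auto
    next
      case 3
      show ?thesis unfolding 3 using profile_interior_deriv[OF p] p'_eq
        by (intro radial[where \<phi>' = p'] p'_alg) simp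
    next
      case 4
      show ?thesis unfolding 4 U_def using profile_primitive_deriv(2)[OF p]
        by (intro radial[where \<phi>' = p] pn)
    qed
    from g consider c where "g = (\<lambda>x. x \<bullet> c)" | "g = (\<lambda>x. inverse (norm x))"
      | "g = (\<lambda>x. p (norm x))" | "g = (\<lambda>x. U (norm x))"
      by (auto simp: G_def)
    then show "\<exists>L. L-lipschitz_on (closure (annulus r R)) g"
    proof cases
      case 1
      then show ?thesis using linear_generator_lipschitz by blast
    next
      case 2
      have "continuous_on {r..R} (\<lambda>t. - (inverse t * inverse t))"
        using r by (intro continuous_intros) auto
      from composed_generator_lipschitz[OF invD this norm_lip image] show ?thesis unfolding 2 by simp
    next
      case 3
      have "continuous_on {r..R} p'"
        unfolding p'_def using r by (intro continuous_intros cont) auto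
      from composed_generator_lipschitz[OF pD this norm_lip image] show ?thesis unfolding 3 .
    next
      case 4
      from composed_generator_lipschitz[OF profile_primitive_deriv(1)[OF p] cont norm_lip image]
      show ?thesis unfolding 4 U_def .
    qed
  qed
  show "smooth_closure (annulus r R) u"
    using algebra_smooth_closure[OF Un] by (simp add: u_def U_def)
  show "0 < \<gamma> \<Longrightarrow> \<gamma> \<le> 1 \<Longrightarrow> Holder_closure k \<gamma> (annulus r R) u"
    using algebra_Holder_closure[OF Un] by (simp add: u_def U_def)
qed

text \<open>
  The constants \<open>\<Gamma>\<close> and \<open>C\<close> solve the two linear equations \<open>-\<alpha> = \<Gamma>/r + C\<close> and
  \<open>p(R) = -\<Gamma>/R + C\<close>, and \<open>\<Gamma>\<close> is negative because \<open>p(R) > -\<alpha>\<close>.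
\<close>

lemma annulus_overdetermined:
  assumes dim: "DIM('a::euclidean_space) \<ge> 2" and r: "0 < r" "r < R" and \<alpha>: "\<alpha> > 0"
    and p: "profile DIM('a) r \<alpha> p" and int: "integral {r..R} p = 0"
  shows "\<exists>C \<Gamma>. \<Gamma> < 0 \<and> overdetermined (annulus r R) (\<lambda>x :: 'a. integral {r..norm x} p) 0 \<Gamma> C"
proof -
  define \<Gamma> where "\<Gamma> = - (\<alpha> + p R) / (1 / r + 1 / R)"
  define C where "C = - \<alpha> - \<Gamma> * (1 / r)"
  have pos: "1 / r + 1 / R > 0" using r by (simp add: add_pos_pos)
  have "\<alpha> + p R > 0" using profile_outer_slope[OF dim r(1) \<alpha> r(2) p int] by simp
  then have "\<Gamma> < 0" unfolding \<Gamma>_def using pos by (intro divide_neg_pos) auto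
  have "\<Gamma> * (1 / r + 1 / R) = - (\<alpha> + p R)" using pos by (simp add: \<Gamma>_def)
  then have C_R: "p R = \<Gamma> * (- 1 / R) + C" by (simp add: C_def distrib_left)
  have p0: "p r = \<alpha>" using p by (simp add: profile_def)
  have cont: "continuous_on {r..R} p"
    by (rule continuous_on_subset[OF profile_continuous_on[OF p]]) auto
  note U = profile_primitive_deriv(2)[OF p]
  have "translator_eq (annulus r R) (\<lambda>x :: 'a. integral {r..norm x} p)"
    by (rule profile_translator_eq[OF open_annulus _ r(1) p U]) (auto simp: annulus_eq[OF r(1)])
  moreover have "integral {r..norm x} p = 0" if "x \<in> frontier (annulus r R)" for x :: 'a
    using that int unfolding frontier_annulus[OF r] by auto
  moreover have "normal_deriv (annulus r R) (\<lambda>x. integral {r..norm x} p) x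
      = \<Gamma> * mean_curvature (annulus r R) x + C" if fr: "x \<in> frontier (annulus r R)" for x :: 'a
  proof -
    from fr consider "norm x = r" | "norm x = R" unfolding frontier_annulus[OF r] by auto
    then show ?thesis
    proof cases
      case 1
      show ?thesis
        using annulus_mean_curvature(1)[OF r dim 1]
          annulus_normal_deriv(1)[where U = "\<lambda>t. integral {r..t} p", OF r U cont 1]
        by (simp add: C_def p0)
    next
      case 2
      show ?thesis
        using annulus_mean_curvature(2)[OF r dim 2]
          annulus_normal_deriv(2)[where U = "\<lambda>t. integral {r..t} p", OF r U cont 2] C_R
        by simp
    qed
  qed
  ultimately show ?thesis
    unfolding overdetermined_def using \<open>\<Gamma> < 0\<close> by blast
qed

section \<open>Rigidity fails without a sign condition\<close>

theorem proposition5p1: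
  fixes r \<alpha> :: real
  assumes "CARD('n::finite) \<ge> 2" and "r > 0" and "\<alpha> > 0"
  shows "(\<exists>p. profile CARD('n) r \<alpha> p \<and>
            (\<forall>q. profile CARD('n) r \<alpha> q \<longrightarrow> (\<forall>\<rho>\<ge>r. q \<rho> = p \<rho>)) \<and>
            (\<exists>!R. R > r \<and>
               (\<exists>(u :: real ^ 'n \<Rightarrow> real) U a C \<Gamma>.
                  (\<forall>\<rho>\<in>{r..R}. (U has_real_derivative p \<rho>) (at \<rho> within {r..R})) \<and>
                  (\<forall>x\<in>closure (annulus r R). u x = U (norm x)) \<and>
                  smooth_closure (annulus r R) u \<and>
                  \<Gamma> < 0 \<and>
                  overdetermined (annulus r R) u a \<Gamma> C)))
       \<and> (\<forall>\<gamma>. 0 < \<gamma> \<and> \<gamma> < 1 \<longrightarrow>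
            \<not> (\<forall>(\<Omega> :: (real ^ 'n) set) u a C \<Gamma>.
                  open \<Omega> \<and> connected \<Omega> \<and> bounded \<Omega> \<and> \<Omega> \<noteq> {} \<and>
                  Holder_boundary 4 \<gamma> \<Omega> \<and> Holder_closure 4 \<gamma> \<Omega> u \<and>
                  overdetermined \<Omega> u a \<Gamma> C
                  \<longrightarrow> (\<exists>x0 R. R > 0 \<and> \<Omega> = ball x0 R)))"
proof -
  have dim: "DIM(real ^ 'n) = CARD('n)" by simp
  have n: "DIM(real ^ 'n) \<ge> 2" unfolding dim by (rule assms(1))
  obtain p where p: "profile DIM(real ^ 'n) r \<alpha> p"
    and lower: "\<And>\<rho>. \<rho> \<ge> r \<Longrightarrow> - \<rho> / (real DIM(real ^ 'n) - 1) \<le> p \<rho>"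
    using profile_exists[OF n assms(2,3)] by blast
  obtain R where R: "R > r" "integral {r..R} p = 0"
    and R_unique: "\<And>R'. R' > r \<Longrightarrow> integral {r..R'} p = 0 \<Longrightarrow> R' = R"
    using profile_radius[OF n assms(2,3) p lower] by blast
  define u where "u = (\<lambda>x :: real ^ 'n. integral {r..norm x} p)"
  obtain C \<Gamma> where \<Gamma>: "\<Gamma> < 0" and over: "overdetermined (annulus r R) u 0 \<Gamma> C"
    using annulus_overdetermined[OF n assms(2) R(1) assms(3) p R(2)] unfolding u_def by blast
  have "\<exists>!R. R > r \<and>
               (\<exists>(u :: real ^ 'n \<Rightarrow> real) U a C \<Gamma>.
                  (\<forall>\<rho>\<in>{r..R}. (U has_real_derivative p \<rho>) (at \<rho> within {r..R})) \<and>
                  (\<forall>x\<in>closure (annulus r R). u x = U (norm x)) \<and>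
                  smooth_closure (annulus r R) u \<and>
                  \<Gamma> < 0 \<and>
                  overdetermined (annulus r R) u a \<Gamma> C)" (is "\<exists>!R. ?P R")
  proof (rule ex1I[of _ R])
    have "\<forall>\<rho>\<in>{r..R}. ((\<lambda>t. integral {r..t} p) has_real_derivative p \<rho>) (at \<rho> within {r..R})"
      using profile_primitive_deriv(1)[OF p] by blast
    moreover have "\<forall>x\<in>closure (annulus r R). u x = (\<lambda>t. integral {r..t} p) (norm x)"
      by (simp add: u_def)
    moreover have "smooth_closure (annulus r R) u"
      unfolding u_def by (rule profile_solution_regular(1)[OF assms(2) R(1) p])
    ultimately show "?P R" using R(1) \<Gamma> over by blast
  next
    fix R' assume "?P R'"
    then obtain u' :: "real ^ 'n \<Rightarrow> real" and U a C' \<Gamma>' where R': "R' > r"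
      and U: "\<And>\<rho>. \<rho> \<in> {r..R'} \<Longrightarrow> (U has_real_derivative p \<rho>) (at \<rho> within {r..R'})"
      and u': "\<And>x. x \<in> closure (annulus r R') \<Longrightarrow> u' x = U (norm x)"
      and bd: "overdetermined (annulus r R') u' a \<Gamma>' C'"
      by blast
    have "U s = a" if s: "s = r \<or> s = R'" for s
    proof -
      obtain b :: "real ^ 'n" where "b \<in> Basis" using nonempty_Basis by blast
      then have "norm (s *\<^sub>R b) = s" using s R' assms(2) by auto
      then have "s *\<^sub>R b \<in> closure (annulus r R')" "s *\<^sub>R b \<in> frontier (annulus r R')"
        using s R' unfolding closure_annulus[OF assms(2) R'] frontier_annulus[OF assms(2) R'] by auto
      then show ?thesis
        using u' bd \<open>norm (s *\<^sub>R b) = s\<close> unfolding overdetermined_def by metis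
    qed
    then have "U r = U R'" by simp
    moreover have "(p has_integral (U R' - U r)) {r..R'}"
      using R' U by (intro fundamental_theorem_of_calculus)
        (auto simp: has_real_derivative_iff_has_vector_derivative[symmetric])
    ultimately have "integral {r..R'} p = 0" by (simp add: integral_unique)
    then show "R' = R" using R' by (intro R_unique)
  qed
  moreover have "\<forall>\<rho>\<ge>r. q \<rho> = p \<rho>" if "profile CARD('n) r \<alpha> q" for q
    using profile_unique[OF _ assms(2) p, of q] that n by simp
  ultimately have first: "\<exists>p. profile CARD('n) r \<alpha> p \<and>
            (\<forall>q. profile CARD('n) r \<alpha> q \<longrightarrow> (\<forall>\<rho>\<ge>r. q \<rho> = p \<rho>)) \<and>
            (\<exists>!R. R > r \<and>
               (\<exists>(u :: real ^ 'n \<Rightarrow> real) U a C \<Gamma>.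
                  (\<forall>\<rho>\<in>{r..R}. (U has_real_derivative p \<rho>) (at \<rho> within {r..R})) \<and>
                  (\<forall>x\<in>closure (annulus r R). u x = U (norm x)) \<and>
                  smooth_closure (annulus r R) u \<and>
                  \<Gamma> < 0 \<and>
                  overdetermined (annulus r R) u a \<Gamma> C))"
    using p[unfolded dim] by blast
  have "\<not> (\<forall>(\<Omega> :: (real ^ 'n) set) u a C \<Gamma>.
                  open \<Omega> \<and> connected \<Omega> \<and> bounded \<Omega> \<and> \<Omega> \<noteq> {} \<and>
                  Holder_boundary 4 \<gamma> \<Omega> \<and> Holder_closure 4 \<gamma> \<Omega> u \<and>
                  overdetermined \<Omega> u a \<Gamma> C
                  \<longrightarrow> (\<exists>x0 R. R > 0 \<and> \<Omega> = ball x0 R))" if \<gamma>: "0 < \<gamma>" "\<gamma> < 1" for \<gamma>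
  proof
    assume rigid: "\<forall>(\<Omega> :: (real ^ 'n) set) u a C \<Gamma>.
                  open \<Omega> \<and> connected \<Omega> \<and> bounded \<Omega> \<and> \<Omega> \<noteq> {} \<and>
                  Holder_boundary 4 \<gamma> \<Omega> \<and> Holder_closure 4 \<gamma> \<Omega> u \<and>
                  overdetermined \<Omega> u a \<Gamma> C
                  \<longrightarrow> (\<exists>x0 R. R > 0 \<and> \<Omega> = ball x0 R)"
    let ?\<Omega> = "annulus r R :: (real ^ 'n) set"
    have "connected ?\<Omega>"
      using connected_annulus(1)[OF n, of r 0 R] by (simp add: annulus_eq[OF assms(2)])
    moreover have "?\<Omega> \<noteq> {}"
    proof -
      have "((r + R) / 2) *\<^sub>R axis undefined 1 \<in> ?\<Omega>"
        using R(1) assms(2) by (simp add: annulus_eq)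
      then show ?thesis by blast
    qed
    moreover have "Holder_boundary 4 \<gamma> ?\<Omega>"
      using \<gamma> by (intro annulus_Holder_boundary assms(2) R(1)) auto
    moreover have "Holder_closure 4 \<gamma> ?\<Omega> u"
      unfolding u_def using \<gamma> by (intro profile_solution_regular(2)[OF assms(2) R(1) p]) auto
    ultimately have "\<exists>x0 s. s > 0 \<and> ?\<Omega> = ball x0 s"
      using rigid over open_annulus bounded_annulus by blast
    then show False using annulus_not_ball[OF assms(2) R(1)] by blast
  qed
  with first show ?thesis by blast
qed

end
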